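(* Let $m>0$, $L>0$, and let $F:\mathcal{P}_2(\mathbb{R}^d)\to\mathbb{R}$ be an $m$-strongly geodesically convex functional that is Wasserstein differentiable at every $\rho\in\mathcal{P}_2(\mathbb{R}^d)$ and satisfies $$\|\nabla_{W_2}F[\rho_0](x)-\nabla_{W_2}F[\rho_1](y)\|_2\le \frac{L}{2}\bigl(\|x-y\|_2+W_2(\rho_0,\rho_1)\bigr)\qquad\text{for all }\rho_0,\rho_1\in\mathcal{P}_2(\mathbb{R}^d),\ x,y\in\mathbb{R}^d.$$ Let $m_F=\min_{\rho\in\mathcal{P}_2(\mathbb{R}^d)}F[\rho]$. Let $\rho_0\in\mathcal{P}_2(\mathbb{R}^d)$ and let $\{\rho_k\}_{k\ge 0}\subset\mathcal{P}_2(\mathbb{R}^d)$ be the sequence of position marginals $\rho_k=\mu_k^X$ generated by the measure-level heavy-ball iteration (defined in the context) with parameters $s=\frac{m}{16L^2}$ and $\beta=\frac{1-\sqrt{ms}}{1+\sqrt{ms}}$. Then $$F[\rho_k]-m_F\le \mathcal{O}\!\left(\left(1+\frac{m}{16L}\right)^{-k}\right),$$ i.e. there is a constant $C\ge 0$ independent of $k$ such that $F[\rho_k]-m_F\le C\left(1+\frac{m}{16L}\right)^{-k}$ for all $k\ge 0$.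
   Context: $\mathcal{P}_2(\mathbb{R}^n)$ is the set of Borel probability measures on $\mathbb{R}^n$ with finite second moment, $W_2$ is the Wasserstein-2 distance, $\Pi_0(\rho_0,\rho_1)$ is the set of optimal couplings for $W_2(\rho_0,\rho_1)$, and $T_\#\nu$ is the pushforward of $\nu$ by $T$. The optimization problem is $m_F=\min_{\rho\in\mathcal{P}_2(\mathbb{R}^d)}F[\rho]$, where $m_F$ denotes the minimum value. Wasserstein gradient: $F:\mathcal{P}_2(\mathbb{R}^d)\to\mathbb{R}$ is Wasserstein differentiable at $\rho$ if there is a vector field $\xi\in L^2(\rho)=\{\xi:\mathbb{R}^d\to\mathbb{R}^d:\int\|\xi\|_2^2\,d\rho<\infty\}$ such that for every $\eta\in\mathcal{P}_2(\mathbb{R}^d)$ and some optimal coupling $\gamma\in\Pi_0(\rho,\eta)$, $$F[\eta]-F[\rho]=\int_{\mathbb{R}^d\times\mathbb{R}^d}\xi(x)\cdot(y-x)\,d\gamma(x,y)+o(W_2(\rho,\eta)).$$ The field $\xi$ of minimal $L^2(\rho)$-norm with this property is the Wasserstein gradient $\nabla_{W_2}F[\rho]$. In the pointwise Lipschitz-type condition and in the iteration, $\nabla_{W_2}F[\rho]$ is understood as a map defined on all of $\mathbb{R}^d$. Geodesic convexity: for $m\ge 0$, $F$ is $m$-geodesically convex ($m$-strongly geodesically convex if $m>0$) if for all $\rho_0,\rho_1\in\mathcal{P}_2(\mathbb{R}^d)$ and every $\gamma\in\Pi_0(\rho_0,\rho_1)$, $$F[\rho_t]\le(1-t)F[\rho_0]+tF[\rho_1]-\frac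 m2 t(1-t)W_2^2(\rho_0,\rho_1),\qquad t\in[0,1],$$ where $\rho_t=(T_t)_\#\gamma$, $T_t(x,y)=(1-t)x+ty$. Measure-level heavy-ball iteration: for $\mu\in\mathcal{P}_2(\mathbb{R}^d\times\mathbb{R}^d)$, with points written $(x,v)$, let $\mu^X$ denote its first ($x$-)marginal. Initialize $$\mu_0=\Bigl(\mathrm{Id},\,-\tfrac{2\sqrt s}{1+\sqrt{ms}}\nabla_{W_2}F[\rho_0]\Bigr)_\#\rho_0 .$$ For $k\ge 1$ set $\hat\mu_k=(T^{\mathrm{drift}})_\#\mu_{k-1}$ and $\mu_k=(T_k^{\mathrm{HB}})_\#\hat\mu_k$, where $$T^{\mathrm{drift}}(x,v)=(x+\sqrt s\,v,\;v),\qquad T_k^{\mathrm{HB}}(x,v)=\bigl(x,\;-\sqrt s\,\nabla_{W_2}F[\hat\rho_k](x)+\beta v\bigr),\qquad \hat\rho_k=\hat\mu_k^X .$$ The iterates are $\rho_k=\mu_k^X$. *)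

theory Defs
  imports "HOL-Probability.Probability" "HOL-Library.Landau_Symbols"
begin

definition P2 :: "'a::euclidean_space measure set" where
  "P2 = {\<rho>. prob_space \<rho> \<and> sets \<rho> = sets borel \<and> integrable \<rho> (\<lambda>x. (norm x)\<^sup>2)}"

definition couplings ::
    "'a::euclidean_space measure \<Rightarrow> 'a measure \<Rightarrow> ('a \<times> 'a) measure set" where
  "couplings \<rho> \<eta> =
     {\<gamma>. sets \<gamma> = sets borel \<and> distr \<gamma> borel fst = \<rho> \<and> distr \<gamma> borel snd = \<eta>}"

definition transport_cost :: "('a::euclidean_space \<times> 'a) measure \<Rightarrow> ennreal" where
  "transport_cost \<gamma> = (\<integral>\<^sup>+ (x, y). ennreal ((norm (x - y))\<^sup>2) \<partial>\<gamma>)"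

text \<open>The infimum is finite for measures in \<^const>\<open>P2\<close>; elsewhere the real number returned
  by \<^const>\<open>enn2real\<close> need not be meaningful.\<close>

definition W2 :: "'a::euclidean_space measure \<Rightarrow> 'a measure \<Rightarrow> real" where
  "W2 \<rho> \<eta> = sqrt (enn2real (INF \<gamma>\<in>couplings \<rho> \<eta>. transport_cost \<gamma>))"

definition optimal_couplings ::
    "'a::euclidean_space measure \<Rightarrow> 'a measure \<Rightarrow> ('a \<times> 'a) measure set" where
  "optimal_couplings \<rho> \<eta> =
     {\<gamma>\<in>couplings \<rho> \<eta>. transport_cost \<gamma> = (INF \<gamma>'\<in>couplings \<rho> \<eta>. transport_cost \<gamma>')}"

definition L2_fields :: "'a::euclidean_space measure \<Rightarrow> ('a \<Rightarrow> 'a) set" where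
  "L2_fields \<rho> = {\<xi>. \<xi> \<in> borel_measurable \<rho> \<and> integrable \<rho> (\<lambda>x. (norm (\<xi> x))\<^sup>2)}"

definition L2_field_norm :: "'a::euclidean_space measure \<Rightarrow> ('a \<Rightarrow> 'a) \<Rightarrow> real" where
  "L2_field_norm \<rho> \<xi> = sqrt (\<integral>x. (norm (\<xi> x))\<^sup>2 \<partial>\<rho>)"

text \<open>A functional on \<^const>\<open>P2\<close> is represented by a function on all measures whose values
  outside \<^const>\<open>P2\<close> are never used.

  In the first-order expansion the optimal coupling may depend on \<open>\<eta>\<close>: \<open>\<gamma>\<close> is a
  selection of one optimal coupling for every \<open>\<eta>\<close>.  The remainder is
  \<open>o(W2 \<rho> \<eta>)\<close> as \<open>W2 \<rho> \<eta> \<rightarrow> 0\<close> with \<open>\<eta>\<close> ranging over \<^const>\<open>P2\<close>.\<close>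

definition wasserstein_expansion ::
    "('a::euclidean_space measure \<Rightarrow> real) \<Rightarrow> 'a measure \<Rightarrow> ('a \<Rightarrow> 'a) \<Rightarrow> bool" where
  "wasserstein_expansion F \<rho> \<xi> \<longleftrightarrow>
     \<xi> \<in> L2_fields \<rho> \<and>
     (\<exists>\<gamma>. (\<forall>\<eta>\<in>P2. \<gamma> \<eta> \<in> optimal_couplings \<rho> \<eta>) \<and>
        (\<lambda>\<eta>. F \<eta> - F \<rho> - (\<integral>(x, y). \<xi> x \<bullet> (y - x) \<partial>\<gamma> \<eta>))
          \<in> o[inf (filtercomap (W2 \<rho>) (nhds 0)) (principal P2)](W2 \<rho>))"

definition wasserstein_differentiable ::
    "('a::euclidean_space measure \<Rightarrow> real) \<Rightarrow> 'a measure \<Rightarrow> bool" where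
  "wasserstein_differentiable F \<rho> \<longleftrightarrow> (\<exists>\<xi>. wasserstein_expansion F \<rho> \<xi>)"

text \<open>A relation rather than a function: the gradient is an \<open>L\<^sup>2(\<rho>)\<close> class, and any
  representative defined on the whole space satisfies the predicate.\<close>

definition is_wasserstein_gradient ::
    "('a::euclidean_space measure \<Rightarrow> real) \<Rightarrow> 'a measure \<Rightarrow> ('a \<Rightarrow> 'a) \<Rightarrow> bool" where
  "is_wasserstein_gradient F \<rho> \<xi> \<longleftrightarrow>
     wasserstein_expansion F \<rho> \<xi> \<and>
     (\<forall>\<xi>'. wasserstein_expansion F \<rho> \<xi>' \<longrightarrow> L2_field_norm \<rho> \<xi> \<le> L2_field_norm \<rho> \<xi>')"

definition geodesically_convex ::
    "real \<Rightarrow> ('a::euclidean_space measure \<Rightarrow> real) \<Rightarrow> bool" where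
  "geodesically_convex m F \<longleftrightarrow>
     (\<forall>\<rho>\<^sub>0\<in>P2. \<forall>\<rho>\<^sub>1\<in>P2. \<forall>\<gamma>\<in>optimal_couplings \<rho>\<^sub>0 \<rho>\<^sub>1. \<forall>t\<in>{0..1}.
        F (distr \<gamma> borel (\<lambda>(x, y). (1 - t) *\<^sub>R x + t *\<^sub>R y))
          \<le> (1 - t) * F \<rho>\<^sub>0 + t * F \<rho>\<^sub>1 - m / 2 * t * (1 - t) * (W2 \<rho>\<^sub>0 \<rho>\<^sub>1)\<^sup>2)"

definition hb_init ::
    "('a::euclidean_space measure \<Rightarrow> 'a \<Rightarrow> 'a) \<Rightarrow> real \<Rightarrow> real \<Rightarrow> 'a measure \<Rightarrow> ('a \<times> 'a) measure" where
  "hb_init G m s \<rho>\<^sub>0 =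
     distr \<rho>\<^sub>0 borel (\<lambda>x. (x, - (2 * sqrt s / (1 + sqrt (m * s))) *\<^sub>R G \<rho>\<^sub>0 x))"

definition hb_drift ::
    "real \<Rightarrow> ('a::euclidean_space \<times> 'a) measure \<Rightarrow> ('a \<times> 'a) measure" where
  "hb_drift s \<mu> = distr \<mu> borel (\<lambda>(x, v). (x + sqrt s *\<^sub>R v, v))"

definition hb_kick ::
    "('a::euclidean_space measure \<Rightarrow> 'a \<Rightarrow> 'a) \<Rightarrow> real \<Rightarrow> real \<Rightarrow> ('a \<times> 'a) measure \<Rightarrow> ('a \<times> 'a) measure" where
  "hb_kick G s \<beta> \<mu> =
     distr \<mu> borel (\<lambda>(x, v). (x, - sqrt s *\<^sub>R G (distr \<mu> borel fst) x + \<beta> *\<^sub>R v))"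

text \<open>Here \<open>G \<rho>\<close> stands for the Wasserstein gradient of the objective at \<open>\<rho>\<close>.\<close>

primrec hb_measure ::
    "('a::euclidean_space measure \<Rightarrow> 'a \<Rightarrow> 'a) \<Rightarrow> real \<Rightarrow> real \<Rightarrow> real \<Rightarrow> 'a measure \<Rightarrow> nat
      \<Rightarrow> ('a \<times> 'a) measure" where
  "hb_measure G m s \<beta> \<rho>\<^sub>0 0 = hb_init G m s \<rho>\<^sub>0"
| "hb_measure G m s \<beta> \<rho>\<^sub>0 (Suc k) = hb_kick G s \<beta> (hb_drift s (hb_measure G m s \<beta> \<rho>\<^sub>0 k))"

definition hb_iterate ::
    "('a::euclidean_space measure \<Rightarrow> 'a \<Rightarrow> 'a) \<Rightarrow> real \<Rightarrow> real \<Rightarrow> real \<Rightarrow> 'a measure \<Rightarrow> nat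
      \<Rightarrow> 'a measure" where
  "hb_iterate G m s \<beta> \<rho>\<^sub>0 k = distr (hb_measure G m s \<beta> \<rho>\<^sub>0 k) borel fst"

end

theory Submission
  imports Defs
begin

text \<open>
  Lift \<open>F\<close> to random variables, \<open>X \<mapsto> F (law X)\<close>, on a fixed probability space. If \<open>X\<close>, \<open>Y\<close> take
  finitely many values and \<open>Z\<^sub>t = (1 - t) X + t Y\<close>, then for \<open>r\<close> near \<open>t\<close> every atom of \<open>Z\<^sub>r\<close> stays
  closer to its own atom of \<open>Z\<^sub>t\<close> than to any other one, so the joint law of \<open>(Z\<^sub>t, Z\<^sub>r)\<close> is the only
  optimal coupling. Hence the lifted functional is differentiable and locally \<open>m\<close>-convex along
  \<open>Z\<^sub>t\<close>; its derivative is continuous by the Lipschitz condition, so local convexity is global.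
  Approximation by simple functions then gives, for arbitrary (not only optimal) couplings,
  \<open>m/2 E|Y - X|\<^sup>2 \<le> F (law Y) - F (law X) - E(\<nabla>F(X) \<bullet> (Y - X)) \<le> L/2 E|Y - X|\<^sup>2\<close>.
  The rate is now that of the heavy-ball method in a Hilbert space: on the product of \<open>\<rho>\<^sub>0\<close> with a
  minimizer \<open>\<rho>\<^sub>*\<close>, with \<open>x\<^sub>*\<close> the second coordinate and \<open>q = m/(4L)\<close>, the Lyapunov function
  \<open>A (F - m\<^sub>F) + E|v|\<^sup>2/4 + E|A v + a (x - x\<^sub>*)|\<^sup>2/4\<close>, where \<open>A = (1 + q)/(1 - q)\<close> and
  \<open>a = 2 \<surd>m/(1 - q)\<close>, shrinks by the factor \<open>1 + q/4\<close> in every step.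
\<close>

section \<open>Square-integrable random vectors\<close>

text \<open>Stated for an arbitrary measure because it is used in three ways: for random vectors on
  a common probability space, for fields on a law \<open>\<rho>\<close> (where it is membership in
  \<open>L2_fields \<rho>\<close>), and for the two coordinates on a coupling.\<close>

definition square_integrable :: "'b measure \<Rightarrow> ('b \<Rightarrow> 'a::euclidean_space) \<Rightarrow> bool" where
  "square_integrable M X \<longleftrightarrow> X \<in> borel_measurable M \<and> integrable M (\<lambda>\<omega>. (norm (X \<omega>))\<^sup>2)"

definition mean_square :: "'b measure \<Rightarrow> ('b \<Rightarrow> 'a::euclidean_space) \<Rightarrow> real" where
  "mean_square M X = (\<integral>\<omega>. (norm (X \<omega>))\<^sup>2 \<partial>M)"

lemma square_integrable_measurable [measurable_dest]:
  "square_integrable M X \<Longrightarrow> X \<in> borel_measurable M"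
  by (simp add: square_integrable_def)

lemma square_integrable_norm_sq: "square_integrable M X \<Longrightarrow> integrable M (\<lambda>\<omega>. (norm (X \<omega>))\<^sup>2)"
  by (simp add: square_integrable_def)

lemma mean_square_nonneg [simp]: "0 \<le> mean_square M X"
  by (simp add: mean_square_def)

lemma square_integrable_inner:
  fixes X Y :: "'a \<Rightarrow> 'b::euclidean_space"
  assumes "square_integrable M X" "square_integrable M Y"
  shows "integrable M (\<lambda>\<omega>. X \<omega> \<bullet> Y \<omega>)"
proof (rule Bochner_Integration.integrable_bound)
  show "integrable M (\<lambda>\<omega>. (norm (X \<omega>))\<^sup>2 + (norm (Y \<omega>))\<^sup>2)"
    using assms by (simp add: square_integrable_norm_sq)
  have "\<bar>x \<bullet> y\<bar> \<le> (norm x)\<^sup>2 + (norm y)\<^sup>2" for x y :: 'b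
  proof -
    have "\<bar>x \<bullet> y\<bar> \<le> norm x * norm y" by (rule Cauchy_Schwarz_ineq2)
    also have "\<dots> \<le> (norm x)\<^sup>2 + (norm y)\<^sup>2"
      using zero_le_power2[of "norm x - norm y"] mult_nonneg_nonneg[of "norm x" "norm y"]
      by (simp add: power2_diff del: zero_le_power2 mult_nonneg_nonneg)
    finally show ?thesis .
  qed
  then show "AE \<omega> in M. norm (X \<omega> \<bullet> Y \<omega>) \<le> norm ((norm (X \<omega>))\<^sup>2 + (norm (Y \<omega>))\<^sup>2)"
    by simp
qed (use assms in \<open>auto simp: square_integrable_def\<close>)

lemma square_integrable_scaleR:
  "square_integrable M X \<Longrightarrow> square_integrable M (\<lambda>\<omega>. c *\<^sub>R X \<omega>)"
  by (auto simp: square_integrable_def power_mult_distrib)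

lemma square_integrable_add:
  assumes "square_integrable M X" "square_integrable M Y"
  shows "square_integrable M (\<lambda>\<omega>. X \<omega> + Y \<omega>)"
proof -
  have "integrable M (\<lambda>\<omega>. (norm (X \<omega>))\<^sup>2 + 2 * (X \<omega> \<bullet> Y \<omega>) + (norm (Y \<omega>))\<^sup>2)"
    using assms by (simp add: square_integrable_norm_sq square_integrable_inner)
  moreover have "(norm (X \<omega> + Y \<omega>))\<^sup>2 = (norm (X \<omega>))\<^sup>2 + 2 * (X \<omega> \<bullet> Y \<omega>) + (norm (Y \<omega>))\<^sup>2" for \<omega>
    by (simp add: power2_norm_eq_inner algebra_simps inner_commute)
  ultimately show ?thesis
    using assms by (auto simp: square_integrable_def)
qed

lemma square_integrable_diff:
  assumes "square_integrable M X" "square_integrable M Y"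
  shows "square_integrable M (\<lambda>\<omega>. X \<omega> - Y \<omega>)"
  using square_integrable_add[OF assms(1) square_integrable_scaleR[OF assms(2), of "-1"]] by simp

lemmas square_integrable_intros =
  square_integrable_scaleR square_integrable_add square_integrable_diff

lemma mean_square_scaleR: "mean_square M (\<lambda>\<omega>. c *\<^sub>R X \<omega>) = c\<^sup>2 * mean_square M X"
  by (simp add: mean_square_def power_mult_distrib)

lemma quadratic_nonneg_imp_discriminant:
  fixes a b c :: real
  assumes "\<And>t. 0 \<le> a * t\<^sup>2 + 2 * b * t + c" "0 \<le> a"
  shows "b\<^sup>2 \<le> a * c"
proof (cases "a = 0")
  case True
  have "b = 0"
  proof (rule ccontr)
    assume "b \<noteq> 0"
    \<comment> \<open>At this \<open>t\<close> the affine function \<open>2 * b * t + c\<close>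
      takes the value -1.\<close>
    then show False using assms(1)[of "- (c + 1) / (2 * b)"] True by (simp add: field_simps)
  qed
  then show ?thesis using True by simp
next
  case False
  then have "a > 0" using assms(2) by simp
  then have "a * (- b / a)\<^sup>2 + 2 * b * (- b / a) + c = c - b\<^sup>2 / a"
    by (simp add: power2_eq_square)
  then have "b\<^sup>2 / a \<le> c" using assms(1)[of "- b / a"] by simp
  then show ?thesis using \<open>a > 0\<close> by (simp add: pos_divide_le_eq mult.commute)
qed

text \<open>E|t X + Y|^2 is a nonnegative quadratic polynomial in t, so its discriminant is not
  positive.\<close>

lemma integral_Cauchy_Schwarz:
  assumes "square_integrable M X" "square_integrable M Y"
  shows "\<bar>\<integral>\<omega>. X \<omega> \<bullet> Y \<omega> \<partial>M\<bar> \<le> sqrt (mean_square M X) * sqrt (mean_square M Y)"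
proof -
  have "(\<integral>\<omega>. X \<omega> \<bullet> Y \<omega> \<partial>M)\<^sup>2 \<le> mean_square M X * mean_square M Y"
  proof (rule quadratic_nonneg_imp_discriminant)
    fix t :: real
    have "0 \<le> (\<integral>\<omega>. (norm (t *\<^sub>R X \<omega> + Y \<omega>))\<^sup>2 \<partial>M)"
      by simp
    also have "\<dots> = (\<integral>\<omega>. t\<^sup>2 * (norm (X \<omega>))\<^sup>2 + 2 * t * (X \<omega> \<bullet> Y \<omega>) + (norm (Y \<omega>))\<^sup>2 \<partial>M)"
      by (intro Bochner_Integration.integral_cong refl, unfold power2_norm_eq_inner)
        (simp add: algebra_simps inner_commute power2_eq_square)
    also have "\<dots> = mean_square M X * t\<^sup>2 + 2 * (\<integral>\<omega>. X \<omega> \<bullet> Y \<omega> \<partial>M) * t + mean_square M Y"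
      using assms by (simp add: square_integrable_norm_sq square_integrable_inner mean_square_def)
    finally show "0 \<le> mean_square M X * t\<^sup>2 + 2 * (\<integral>\<omega>. X \<omega> \<bullet> Y \<omega> \<partial>M) * t + mean_square M Y" .
  qed simp
  then have "sqrt ((\<integral>\<omega>. X \<omega> \<bullet> Y \<omega> \<partial>M)\<^sup>2) \<le> sqrt (mean_square M X * mean_square M Y)"
    by (rule real_sqrt_le_mono)
  then show ?thesis
    by (simp add: real_sqrt_mult)
qed

text \<open>With d = U - u and e = V - v the error is E(d.e) + E(d.v) + E(u.e), and Cauchy-Schwarz
  sends each term to zero. It is used to pass to the limit both in gradient pairings and in mean
  squares.\<close>

lemma tendsto_integral_inner:
  assumes sq: "\<And>n. square_integrable M (U n)" "\<And>n. square_integrable M (V n)"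
      "square_integrable M u" "square_integrable M v"
    and U: "((\<lambda>n. mean_square M (\<lambda>\<omega>. U n \<omega> - u \<omega>)) \<longlongrightarrow> 0) A"
    and V: "((\<lambda>n. mean_square M (\<lambda>\<omega>. V n \<omega> - v \<omega>)) \<longlongrightarrow> 0) A"
  shows "((\<lambda>n. \<integral>\<omega>. U n \<omega> \<bullet> V n \<omega> \<partial>M) \<longlongrightarrow> (\<integral>\<omega>. u \<omega> \<bullet> v \<omega> \<partial>M)) A"
proof (rule Lim_null[THEN iffD2], rule Lim_null_comparison)
  let ?N = "\<lambda>X. sqrt (mean_square M X)"
  let ?d = "\<lambda>n \<omega>. U n \<omega> - u \<omega>" and ?e = "\<lambda>n \<omega>. V n \<omega> - v \<omega>"
  show "\<forall>\<^sub>F n in A. norm ((\<integral>\<omega>. U n \<omega> \<bullet> V n \<omega> \<partial>M) - (\<integral>\<omega>. u \<omega> \<bullet> v \<omega> \<partial>M))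
      \<le> ?N (?d n) * ?N (?e n) + ?N (?d n) * ?N v + ?N u * ?N (?e n)"
  proof (rule always_eventually, rule allI)
    fix n
    have I: "integrable M (\<lambda>\<omega>. ?d n \<omega> \<bullet> ?e n \<omega>)" "integrable M (\<lambda>\<omega>. ?d n \<omega> \<bullet> v \<omega>)"
      "integrable M (\<lambda>\<omega>. u \<omega> \<bullet> ?e n \<omega>)"
      by (intro square_integrable_inner square_integrable_diff sq)+
    have "(\<integral>\<omega>. U n \<omega> \<bullet> V n \<omega> \<partial>M) - (\<integral>\<omega>. u \<omega> \<bullet> v \<omega> \<partial>M)
        = (\<integral>\<omega>. U n \<omega> \<bullet> V n \<omega> - u \<omega> \<bullet> v \<omega> \<partial>M)"
      by (rule Bochner_Integration.integral_diff[symmetric]) (intro square_integrable_inner sq)+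
    also have "\<dots> = (\<integral>\<omega>. ?d n \<omega> \<bullet> ?e n \<omega> + ?d n \<omega> \<bullet> v \<omega> + u \<omega> \<bullet> ?e n \<omega> \<partial>M)"
      by (simp add: algebra_simps)
    also have "\<dots> = (\<integral>\<omega>. ?d n \<omega> \<bullet> ?e n \<omega> \<partial>M) + (\<integral>\<omega>. ?d n \<omega> \<bullet> v \<omega> \<partial>M) + (\<integral>\<omega>. u \<omega> \<bullet> ?e n \<omega> \<partial>M)"
      using I by simp
    finally have eq: "(\<integral>\<omega>. U n \<omega> \<bullet> V n \<omega> \<partial>M) - (\<integral>\<omega>. u \<omega> \<bullet> v \<omega> \<partial>M) = \<dots>" .
    have "\<bar>\<integral>\<omega>. ?d n \<omega> \<bullet> ?e n \<omega> \<partial>M\<bar> \<le> ?N (?d n) * ?N (?e n)"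
      "\<bar>\<integral>\<omega>. ?d n \<omega> \<bullet> v \<omega> \<partial>M\<bar> \<le> ?N (?d n) * ?N v" "\<bar>\<integral>\<omega>. u \<omega> \<bullet> ?e n \<omega> \<partial>M\<bar> \<le> ?N u * ?N (?e n)"
      by (intro integral_Cauchy_Schwarz square_integrable_diff sq)+
    then show "norm ((\<integral>\<omega>. U n \<omega> \<bullet> V n \<omega> \<partial>M) - (\<integral>\<omega>. u \<omega> \<bullet> v \<omega> \<partial>M))
      \<le> ?N (?d n) * ?N (?e n) + ?N (?d n) * ?N v + ?N u * ?N (?e n)"
      unfolding eq real_norm_def by linarith
  qed
  have "((\<lambda>n. ?N (?d n)) \<longlongrightarrow> 0) A" "((\<lambda>n. ?N (?e n)) \<longlongrightarrow> 0) A"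
    using tendsto_real_sqrt[OF U] tendsto_real_sqrt[OF V] by simp_all
  then show "((\<lambda>n. ?N (?d n) * ?N (?e n) + ?N (?d n) * ?N v + ?N u * ?N (?e n)) \<longlongrightarrow> 0) A"
    by (auto intro!: tendsto_add_zero tendsto_mult_zero tendsto_mult_left_zero tendsto_mult_right_zero)
qed

lemma simple_function_square_integrable:
  assumes "prob_space M" "simple_function M X"
  shows "square_integrable M X"
proof -
  interpret prob_space M by fact
  have "X \<in> borel_measurable M" using assms(2) by (rule borel_measurable_simple_function)
  moreover have "finite ((\<lambda>\<omega>. (norm (X \<omega>))\<^sup>2) ` space M)"
    using simple_functionD(1)[OF assms(2)] by (simp add: image_image[symmetric, of "\<lambda>x. (norm x)\<^sup>2" X])
  then obtain B where "\<forall>y\<in>(\<lambda>\<omega>. (norm (X \<omega>))\<^sup>2) ` space M. norm y \<le> B"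
    by (meson finite_imp_bounded bounded_iff)
  ultimately show ?thesis
    unfolding square_integrable_def by (auto intro!: integrable_const_bound[of _ B])
qed

lemma square_integrable_simple_approximation:
  assumes "square_integrable M X" "prob_space M"
  obtains S where "\<And>n. simple_function M (S n)"
    "(\<lambda>n. mean_square M (\<lambda>\<omega>. S n \<omega> - X \<omega>)) \<longlonglongrightarrow> 0"
proof -
  interpret prob_space M by fact
  note [measurable] = square_integrable_measurable[OF assms(1)]
  obtain S where S: "\<And>n. simple_function M (S n)"
    "\<And>\<omega>. \<omega> \<in> space M \<Longrightarrow> (\<lambda>n. S n \<omega>) \<longlonglongrightarrow> X \<omega>"
    "\<And>n \<omega>. \<omega> \<in> space M \<Longrightarrow> norm (S n \<omega>) \<le> 2 * norm (X \<omega>)"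
    using borel_measurable_implies_sequence_metric[of X M 0] by simp metis
  note [measurable] = borel_measurable_simple_function[OF S(1)]
  have "(\<lambda>n. \<integral>\<omega>. (norm (S n \<omega> - X \<omega>))\<^sup>2 \<partial>M) \<longlonglongrightarrow> (\<integral>\<omega>. 0 \<partial>M)"
  proof (rule integral_dominated_convergence)
    \<comment> \<open>From |S n| <= 2 |X| follows |S n - X| <= 3 |X|, hence the dominating function
      9 |X|^2.\<close>
    show "integrable M (\<lambda>\<omega>. 9 * (norm (X \<omega>))\<^sup>2)"
      using assms(1) by (simp add: square_integrable_norm_sq)
    show "AE \<omega> in M. (\<lambda>n. (norm (S n \<omega> - X \<omega>))\<^sup>2) \<longlonglongrightarrow> 0"
    proof (rule AE_I2)
      fix \<omega> assume "\<omega> \<in> space M"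
      then have "(\<lambda>n. (norm (S n \<omega> - X \<omega>))\<^sup>2) \<longlonglongrightarrow> (norm (X \<omega> - X \<omega>))\<^sup>2"
        by (intro tendsto_intros S)
      then show "(\<lambda>n. (norm (S n \<omega> - X \<omega>))\<^sup>2) \<longlonglongrightarrow> 0" by simp
    qed
    fix n
    show "AE \<omega> in M. norm ((norm (S n \<omega> - X \<omega>))\<^sup>2) \<le> 9 * (norm (X \<omega>))\<^sup>2"
    proof (rule AE_I2)
      fix \<omega> assume "\<omega> \<in> space M"
      then have "norm (S n \<omega> - X \<omega>) \<le> 3 * norm (X \<omega>)"
        using S(3)[of \<omega> n] norm_triangle_ineq4[of "S n \<omega>" "X \<omega>"] by linarith
      then have "(norm (S n \<omega> - X \<omega>))\<^sup>2 \<le> (3 * norm (X \<omega>))\<^sup>2"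
        by (intro power_mono) auto
      then show "norm ((norm (S n \<omega> - X \<omega>))\<^sup>2) \<le> 9 * (norm (X \<omega>))\<^sup>2"
        by (simp add: power_mult_distrib)
    qed
  qed measurable
  then show ?thesis
    using that[of S] S(1) by (simp add: mean_square_def)
qed

lemma square_integrable_distr:
  assumes [measurable]: "X \<in> measurable M borel" "\<xi> \<in> borel_measurable borel"
  shows "square_integrable (distr M borel X) \<xi> \<longleftrightarrow> square_integrable M (\<lambda>\<omega>. \<xi> (X \<omega>))"
  by (simp add: square_integrable_def integrable_distr_eq)

lemma mean_square_distr:
  assumes [measurable]: "X \<in> measurable M borel" "\<xi> \<in> borel_measurable borel"
  shows "mean_square (distr M borel X) \<xi> = mean_square M (\<lambda>\<omega>. \<xi> (X \<omega>))"
  by (simp add: mean_square_def integral_distr)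

section \<open>Functions of one real variable: from local to global\<close>

text \<open>The points of [a, b] whose value is at least \<open>k a\<close> form a compact set, so
  there is a largest one, \<open>d\<close>. If \<open>d < b\<close>, the local hypothesis at
  \<open>d\<close> would supply a larger one.\<close>

lemma continuous_locally_right_mono:
  fixes k :: "real \<Rightarrow> real"
  assumes "continuous_on UNIV k" "a \<le> b"
    and "\<And>t. \<forall>\<^sub>F u in at_right t. k t \<le> k u"
  shows "k a \<le> k b"
proof -
  define T where "T = {t \<in> {a..b}. k a \<le> k t}"
  have "closed T"
    unfolding T_def using continuous_on_subset[OF assms(1), of "{a..b}"]
    by (intro continuous_on_closed_Collect_le continuous_on_const) auto
  then have "compact T"
    by (auto simp: compact_eq_bounded_closed T_def intro: bounded_subset[of "{a..b}"])
  moreover have "a \<in> T" using assms(2) by (simp add: T_def)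
  ultimately obtain d where d: "d \<in> T" "\<And>t. t \<in> T \<Longrightarrow> t \<le> d"
    using compact_attains_sup[of T] by blast
  have "d = b"
  proof (rule ccontr)
    assume "d \<noteq> b"
    then have db: "d < b" "a \<le> d" "k a \<le> k d" using d(1) by (auto simp: T_def)
    have "\<forall>\<^sub>F u in at_right d. k d \<le> k u \<and> u \<in> {d<..<b}"
      using assms(3) db(1) by (intro eventually_conj eventually_at_right_real) auto
    then obtain u where "k d \<le> k u" "u \<in> {d<..<b}"
      using eventually_happens[of _ "at_right d"] by auto
    then have "u \<in> T" using db by (auto simp: T_def)
    with d(2) \<open>u \<in> {d<..<b}\<close> show False by force
  qed
  then show ?thesis using d(1) by (simp add: T_def)
qed

text \<open>The gap \<open>\<theta>\<close> between the strongly convex upper bound and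
  \<open>\<psi>\<close> is nonnegative on [0, 1] and vanishes at both ends, so its derivative is >=
  0 at 0 and <= 0 at 1. The difference of these two inequalities is the claim.\<close>

lemma strongly_convex_derivative_gap:
  fixes \<psi> :: "real \<Rightarrow> real"
  assumes conv: "\<And>u. u \<in> {0..1} \<Longrightarrow> \<psi> u \<le> (1 - u) * \<psi> 0 + u * \<psi> 1 - K / 2 * u * (1 - u)"
    and a: "(\<psi> has_real_derivative a) (at 0)" and b: "(\<psi> has_real_derivative b) (at 1)"
  shows "K \<le> b - a"
proof -
  define \<theta> where "\<theta> u = (1 - u) * \<psi> 0 + u * \<psi> 1 - K / 2 * u * (1 - u) - \<psi> u" for u
  have 0: "(\<theta> has_real_derivative (\<psi> 1 - \<psi> 0 - K / 2 - a)) (at 0)"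
    unfolding \<theta>_def[abs_def] by (auto intro!: derivative_eq_intros a)
  have 1: "(\<theta> has_real_derivative (\<psi> 1 - \<psi> 0 + K / 2 - b)) (at 1)"
    unfolding \<theta>_def[abs_def] by (auto intro!: derivative_eq_intros b)
  have ge: "0 \<le> \<theta> u" if "u \<in> {0..1}" for u using conv[OF that] by (simp add: \<theta>_def)
  have end0: "\<theta> 0 = 0" "\<theta> 1 = 0" by (simp_all add: \<theta>_def)
  have "\<not> \<psi> 1 - \<psi> 0 - K / 2 - a < 0"
  proof
    assume "\<psi> 1 - \<psi> 0 - K / 2 - a < 0"
    then obtain d where d: "d > 0" "\<forall>h>0. h < d \<longrightarrow> \<theta> 0 > \<theta> (0 + h)"
      using DERIV_neg_dec_right[OF 0] by auto
    then have "\<theta> (min (d / 2) 1) < 0" using end0 by simp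
    then show False using ge[of "min (d / 2) 1"] d(1) by simp
  qed
  moreover have "\<not> \<psi> 1 - \<psi> 0 + K / 2 - b > 0"
  proof
    assume "\<psi> 1 - \<psi> 0 + K / 2 - b > 0"
    then obtain d where d: "d > 0" "\<forall>h>0. h < d \<longrightarrow> \<theta> (1 - h) < \<theta> 1"
      using DERIV_pos_inc_left[OF 1] by auto
    then have "\<theta> (1 - min (d / 2) 1) < 0" using end0 by simp
    then show False using ge[of "1 - min (d / 2) 1"] d(1) by simp
  qed
  ultimately show ?thesis by simp
qed

text \<open>Convexity is assumed only on short intervals to the right of each \<open>t\<close>, of a
  length depending on \<open>t\<close>, which is the form available when optimal couplings are known
  only for nearby times. It bounds each value of \<open>g t - K * t\<close> by the values shortly to
  its right; continuity of \<open>g\<close> makes this global. Integrating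
  \<open>g 0 + K * t \<le> g t \<le> g 0 + C * t\<close> over [0, 1] gives both bounds.\<close>

lemma two_sided_quadratic_bound:
  fixes \<phi> g :: "real \<Rightarrow> real"
  assumes deriv: "\<And>t. (\<phi> has_real_derivative g t) (at t)"
    and conv: "\<And>t. \<forall>\<^sub>F r in at_right t. \<forall>u\<in>{0..1}.
      \<phi> ((1 - u) * t + u * r) \<le> (1 - u) * \<phi> t + u * \<phi> r - K * (r - t)\<^sup>2 / 2 * u * (1 - u)"
    and lip: "\<And>t r. \<bar>g t - g r\<bar> \<le> C * \<bar>t - r\<bar>"
  shows "K / 2 \<le> \<phi> 1 - \<phi> 0 - g 0" "\<phi> 1 - \<phi> 0 - g 0 \<le> C / 2"
proof -
  have "isCont g t" for t
  proof -
    have "((\<lambda>r. C * \<bar>r - t\<bar>) \<longlongrightarrow> C * \<bar>t - t\<bar>) (at t)"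
      by (intro tendsto_intros)
    then have "((\<lambda>r. C * \<bar>r - t\<bar>) \<longlongrightarrow> 0) (at t)" by simp
    moreover have "\<forall>\<^sub>F r in at t. norm (g r - g t) \<le> C * \<bar>r - t\<bar>"
      by (auto intro!: always_eventually lip)
    ultimately show ?thesis
      unfolding isCont_def by (subst Lim_null) (rule Lim_null_comparison)
  qed
  then have contg: "continuous_on A g" for A by (simp add: continuous_at_imp_continuous_on)
  have int_g: "(g has_integral (\<phi> 1 - \<phi> 0)) {0..1}"
    by (rule fundamental_theorem_of_calculus)
      (auto simp: has_real_derivative_iff_has_vector_derivative[symmetric] intro: deriv has_field_derivative_at_within)
  have int_lin: "((\<lambda>t. g 0 + c * t) has_integral (g 0 + c / 2)) {0..1}" for c
  proof -
    have "((\<lambda>t. g 0 + c * t) has_integral ((g 0 * 1 + c * 1\<^sup>2 / 2) - (g 0 * 0 + c * 0\<^sup>2 / 2))) {0..1}"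
      by (rule fundamental_theorem_of_calculus)
        (auto intro!: derivative_eq_intros simp: has_real_derivative_iff_has_vector_derivative[symmetric])
    then show ?thesis by simp
  qed
  have mono: "g 0 + K * t \<le> g t" if "t \<in> {0..1}" for t
  proof -
    have "g 0 - K * 0 \<le> g t - K * t"
    proof (rule continuous_locally_right_mono[of "\<lambda>t. g t - K * t"])
      show "continuous_on UNIV (\<lambda>t. g t - K * t)" by (intro continuous_intros contg)
      show "0 \<le> t" using that by simp
      fix t
      show "\<forall>\<^sub>F r in at_right t. g t - K * t \<le> g r - K * r"
        using conv[of t] eventually_at_right_less[of t]
      proof eventually_elim
        case (elim r)
        \<comment> \<open>Rescaling [t, r] to [0, 1] multiplies the derivatives by
          \<open>r - t\<close>, so the modulus \<open>K * (r - t)\<^sup>2\<close> may be divided by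
          \<open>r - t > 0\<close> afterwards.\<close>
        define \<psi> where "\<psi> u = \<phi> (t + u * (r - t))" for u
        have \<psi>0: "(\<psi> has_real_derivative g t * (r - t)) (at 0)"
          unfolding \<psi>_def[abs_def] using deriv[of t]
          by (auto intro!: DERIV_chain2[where f = \<phi>] derivative_eq_intros)
        have \<psi>1: "(\<psi> has_real_derivative g r * (r - t)) (at 1)"
          unfolding \<psi>_def[abs_def] using deriv[of r] elim
          by (auto intro!: DERIV_chain2[where f = \<phi>] derivative_eq_intros)
        have conv\<psi>: "\<psi> u \<le> (1 - u) * \<psi> 0 + u * \<psi> 1 - K * (r - t)\<^sup>2 / 2 * u * (1 - u)"
          if "u \<in> {0..1}" for u
        proof -
          have "t + u * (r - t) = (1 - u) * t + u * r" by (simp add: algebra_simps)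
          then show ?thesis using elim that by (simp add: \<psi>_def)
        qed
        have "K * (r - t)\<^sup>2 \<le> g r * (r - t) - g t * (r - t)"
          using conv\<psi> \<psi>0 \<psi>1 by (rule strongly_convex_derivative_gap)
        then have "(K * (r - t)) * (r - t) \<le> (g r - g t) * (r - t)"
          by (simp add: power2_eq_square algebra_simps)
        then have "K * (r - t) \<le> g r - g t"
          using elim by (simp add: mult_le_cancel_right)
        then show ?case by (simp add: algebra_simps)
      qed
    qed
    then show ?thesis by simp
  qed
  have upper: "g t \<le> g 0 + C * t" if "t \<in> {0..1}" for t
    using lip[of t 0] that by (auto simp: abs_le_iff)
  show "K / 2 \<le> \<phi> 1 - \<phi> 0 - g 0"
    using has_integral_le[OF int_lin int_g mono] by simp
  show "\<phi> 1 - \<phi> 0 - g 0 \<le> C / 2"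
    using has_integral_le[OF int_g int_lin upper] by simp
qed

section \<open>Optimal couplings\<close>

lemma distr_in_P2:
  assumes "prob_space M" "square_integrable M X"
  shows "distr M borel X \<in> P2"
proof -
  have [measurable]: "X \<in> borel_measurable M" using assms(2) by (simp add: square_integrable_def)
  have "square_integrable (distr M borel X) (\<lambda>x. x)"
    using assms(2) by (simp add: square_integrable_distr)
  then show ?thesis
    using assms(1) by (simp add: P2_def square_integrable_def prob_space.prob_space_distr)
qed

lemma P2_D:
  assumes "\<rho> \<in> P2"
  shows "prob_space \<rho>" "sets \<rho> = sets borel" "square_integrable \<rho> (\<lambda>x. x)" "distr \<rho> borel (\<lambda>x. x) = \<rho>"
proof -
  show "prob_space \<rho>" and sets: "sets \<rho> = sets borel" using assms by (simp_all add: P2_def)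
  have "(\<lambda>x. x) \<in> borel_measurable \<rho>"
    by (simp add: measurable_ident_sets[OF sets])
  then show "square_integrable \<rho> (\<lambda>x. x)" using assms by (simp add: P2_def square_integrable_def)
  show "distr \<rho> borel (\<lambda>x. x) = \<rho>" using distr_id2[OF sets[symmetric]] by simp
qed

lemma square_integrable_of_distr:
  assumes "distr M borel X \<in> P2" "X \<in> borel_measurable M"
  shows "square_integrable M X"
  using P2_D(3)[OF assms(1)] square_integrable_distr[OF assms(2), of "\<lambda>x. x"] by simp

lemma borel_measurable_fst_snd [measurable, simp]:
  "(fst :: 'a::second_countable_topology \<times> 'b::second_countable_topology \<Rightarrow> 'a) \<in> borel_measurable borel"
  "(snd :: 'a::second_countable_topology \<times> 'b::second_countable_topology \<Rightarrow> 'b) \<in> borel_measurable borel"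
  by (intro borel_measurable_continuous_onI continuous_intros)+

lemma joint_law_in_couplings:
  fixes X Y :: "'b \<Rightarrow> 'a::euclidean_space"
  assumes [measurable]: "X \<in> borel_measurable M" "Y \<in> borel_measurable M"
  shows "distr M borel (\<lambda>\<omega>. (X \<omega>, Y \<omega>)) \<in> couplings (distr M borel X) (distr M borel Y)"
  by (simp add: couplings_def distr_distr comp_def)

lemma transport_cost_joint_law:
  fixes X Y :: "'b \<Rightarrow> 'a::euclidean_space"
  assumes "square_integrable M X" "square_integrable M Y"
  shows "transport_cost (distr M borel (\<lambda>\<omega>. (X \<omega>, Y \<omega>))) = ennreal (mean_square M (\<lambda>\<omega>. X \<omega> - Y \<omega>))"
proof -
  have [measurable]: "X \<in> borel_measurable M" "Y \<in> borel_measurable M"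
    using assms by (simp_all add: square_integrable_def)
  have "transport_cost (distr M borel (\<lambda>\<omega>. (X \<omega>, Y \<omega>))) = (\<integral>\<^sup>+ \<omega>. ennreal ((norm (X \<omega> - Y \<omega>))\<^sup>2) \<partial>M)"
    unfolding transport_cost_def by (subst nn_integral_distr) (simp_all add: case_prod_unfold)
  then show ?thesis
    using square_integrable_diff[OF assms]
    by (simp add: mean_square_def nn_integral_eq_integral square_integrable_norm_sq)
qed

lemma W2_nonneg [simp]: "0 \<le> W2 \<rho> \<eta>"
  by (simp add: W2_def)

text \<open>The joint law of \<open>X\<close> and \<open>Y\<close> competes in the infimum, with the
  mean square of the difference as its cost.\<close>

lemma W2_distr_le:
  fixes X Y :: "'b \<Rightarrow> 'a::euclidean_space"
  assumes "square_integrable M X" "square_integrable M Y"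
  shows "W2 (distr M borel X) (distr M borel Y) \<le> sqrt (mean_square M (\<lambda>\<omega>. X \<omega> - Y \<omega>))"
proof -
  have "distr M borel (\<lambda>\<omega>. (X \<omega>, Y \<omega>)) \<in> couplings (distr M borel X) (distr M borel Y)"
    using assms by (intro joint_law_in_couplings) (simp_all add: square_integrable_def)
  then have "(INF \<gamma>\<in>couplings (distr M borel X) (distr M borel Y). transport_cost \<gamma>)
      \<le> ennreal (mean_square M (\<lambda>\<omega>. X \<omega> - Y \<omega>))"
    by (rule INF_lower2) (simp add: transport_cost_joint_law[OF assms])
  then have "enn2real (INF \<gamma>\<in>couplings (distr M borel X) (distr M borel Y). transport_cost \<gamma>)
      \<le> mean_square M (\<lambda>\<omega>. X \<omega> - Y \<omega>)"
    by (intro enn2real_leI) simp_all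
  then show ?thesis unfolding W2_def by (rule real_sqrt_le_mono)
qed

text \<open>A coupling is itself a probability space carrying the random vectors \<open>fst\<close>
  and \<open>snd\<close>; in this way the estimates for random vectors apply to it.\<close>

lemma coupling_square_integrable:
  assumes \<gamma>: "\<gamma> \<in> couplings \<rho> \<eta>" and P2: "\<rho> \<in> P2" "\<eta> \<in> P2"
  shows "prob_space \<gamma>" "square_integrable \<gamma> fst" "square_integrable \<gamma> snd"
proof -
  have sets [measurable_cong]: "sets \<gamma> = sets borel" and d: "distr \<gamma> borel fst = \<rho>" "distr \<gamma> borel snd = \<eta>"
    using \<gamma> by (simp_all add: couplings_def)
  have m [measurable]: "fst \<in> borel_measurable \<gamma>" "snd \<in> borel_measurable \<gamma>"
    by measurable
  show "prob_space \<gamma>" using P2_D(1)[OF P2(1)] d m(1) by (metis prob_space_distrD)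
  show "square_integrable \<gamma> fst" "square_integrable \<gamma> snd"
    using P2 d m by (simp_all add: square_integrable_of_distr)
qed

lemma W2_eq_transport_cost:
  "\<gamma> \<in> optimal_couplings \<rho> \<eta> \<Longrightarrow> W2 \<rho> \<eta> = sqrt (enn2real (transport_cost \<gamma>))"
  by (simp add: optimal_couplings_def W2_def)

lemma W2_eq_mean_square:
  assumes \<gamma>: "\<gamma> \<in> optimal_couplings \<rho> \<eta>" and P2: "\<rho> \<in> P2" "\<eta> \<in> P2"
  shows "W2 \<rho> \<eta> = sqrt (mean_square \<gamma> (\<lambda>z. snd z - fst z))"
proof -
  have c: "\<gamma> \<in> couplings \<rho> \<eta>" using \<gamma> by (simp add: optimal_couplings_def)
  note s = coupling_square_integrable[OF c P2]
  have "distr \<gamma> borel (\<lambda>z. (fst z, snd z)) = \<gamma>"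
    using c by (simp add: couplings_def distr_id2)
  then have "transport_cost \<gamma> = ennreal (mean_square \<gamma> (\<lambda>z. fst z - snd z))"
    using transport_cost_joint_law[OF s(2,3)] by simp
  then show ?thesis
    using W2_eq_transport_cost[OF \<gamma>] by (simp add: mean_square_def norm_minus_commute)
qed

text \<open>By \<open>near\<close>, \<open>X \<omega>\<close> is the only atom of \<open>X\<close>
  nearest to \<open>Y \<omega>\<close>, so \<open>X = n(Y)\<close> for a map \<open>n\<close>. Any
  coupling lives on pairs of atoms and pays at least |n(y) - y|^2 at (x, y). The integral of this
  lower bound depends only on the second marginal, and the joint law attains it. A coupling that
  also attains it must satisfy x = n(y) almost everywhere.\<close>

lemma unique_optimal_coupling:
  fixes X Y :: "'b \<Rightarrow> 'a::euclidean_space"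
  assumes M: "prob_space M" and sX: "simple_function M X" and sY: "simple_function M Y"
    and near: "\<And>\<omega> \<omega>'. \<omega> \<in> space M \<Longrightarrow> \<omega>' \<in> space M \<Longrightarrow> X \<omega> \<noteq> X \<omega>' \<Longrightarrow>
      norm (X \<omega> - Y \<omega>) < norm (X \<omega>' - Y \<omega>)"
  shows "optimal_couplings (distr M borel X) (distr M borel Y) = {distr M borel (\<lambda>\<omega>. (X \<omega>, Y \<omega>))}"
proof -
  interpret prob_space M by fact
  let ?\<rho> = "distr M borel X" and ?\<eta> = "distr M borel Y" and ?J = "distr M borel (\<lambda>\<omega>. (X \<omega>, Y \<omega>))"
  note sq = simple_function_square_integrable[OF M sX] simple_function_square_integrable[OF M sY]
  have [measurable]: "X \<in> borel_measurable M" "Y \<in> borel_measurable M"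
    using sX sY by (simp_all add: borel_measurable_simple_function)
  have fin: "finite (X ` space M)" "finite (Y ` space M)"
    using sX sY by (simp_all add: simple_functionD)
  \<comment> \<open>The choice of \<open>\<omega>\<close> is harmless: if
    \<open>Y \<omega> = Y \<omega>'\<close> but \<open>X \<omega> \<noteq> X \<omega>'\<close>, then
    \<open>near\<close> used both ways would make each distance strictly smaller than the other. The
    finite sum over atoms makes \<open>n\<close> Borel.\<close>
  define n where "n y = (\<Sum>z\<in>Y ` space M. indicator {z} y *\<^sub>R X (SOME \<omega>. \<omega> \<in> space M \<and> Y \<omega> = z))" for y
  have [measurable]: "n \<in> borel_measurable borel" unfolding n_def by measurable
  have n: "n (Y \<omega>) = X \<omega>" if \<omega>: "\<omega> \<in> space M" for \<omega>
  proof -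
    define \<omega>' where "\<omega>' = (SOME \<omega>'. \<omega>' \<in> space M \<and> Y \<omega>' = Y \<omega>)"
    have "\<omega>' \<in> space M \<and> Y \<omega>' = Y \<omega>"
      unfolding \<omega>'_def by (rule someI[of _ \<omega>]) (simp add: \<omega>)
    moreover have "n (Y \<omega>) = (\<Sum>z\<in>Y ` space M. if z = Y \<omega> then X (SOME \<omega>. \<omega> \<in> space M \<and> Y \<omega> = z) else 0)"
      unfolding n_def by (intro sum.cong) (auto simp: indicator_def)
    then have "n (Y \<omega>) = X \<omega>'"
      using fin(2) \<omega> by (simp add: \<omega>'_def)
    ultimately show ?thesis using near[of \<omega> \<omega>'] near[of \<omega>' \<omega>] \<omega> by force
  qed
  \<comment> \<open>The first conjunct gives optimality of the joint law, the second, about the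
    equality case, gives uniqueness.\<close>
  have fst_le: "AE z in \<gamma>. norm (n (snd z) - snd z) \<le> norm (fst z - snd z) \<and>
      (norm (n (snd z) - snd z) = norm (fst z - snd z) \<longrightarrow> n (snd z) = fst z)"
    if \<gamma>: "\<gamma> \<in> couplings ?\<rho> ?\<eta>" for \<gamma>
  proof -
    have [measurable_cong]: "sets \<gamma> = sets borel"
      and marg: "distr \<gamma> borel fst = ?\<rho>" "distr \<gamma> borel snd = ?\<eta>"
      using \<gamma> by (simp_all add: couplings_def)
    have ranges: "X ` space M \<in> sets borel" "Y ` space M \<in> sets borel"
      using fin by (auto intro!: borel_closed finite_imp_closed)
    then have "AE x in ?\<rho>. x \<in> X ` space M" "AE y in ?\<eta>. y \<in> Y ` space M"
      by (subst AE_distr_iff; simp)+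
    then have "AE x in distr \<gamma> borel fst. x \<in> X ` space M" "AE y in distr \<gamma> borel snd. y \<in> Y ` space M"
      unfolding marg .
    then have "AE z in \<gamma>. fst z \<in> X ` space M" "AE z in \<gamma>. snd z \<in> Y ` space M"
      by (auto dest!: AE_distrD[rotated])
    then show ?thesis
    proof eventually_elim
      case (elim z)
      then obtain \<omega> \<omega>' where "\<omega> \<in> space M" "snd z = Y \<omega>" "\<omega>' \<in> space M" "fst z = X \<omega>'" by auto
      then show ?case using near[of \<omega> \<omega>'] n[of \<omega>] by (cases "X \<omega> = X \<omega>'") auto
    qed
  qed
  have cost_n: "(\<integral>\<^sup>+ z. ennreal ((norm (n (snd z) - snd z))\<^sup>2) \<partial>\<gamma>) = transport_cost ?J"
    if \<gamma>: "\<gamma> \<in> couplings ?\<rho> ?\<eta>" for \<gamma>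
  proof -
    have [measurable_cong]: "sets \<gamma> = sets borel" using \<gamma> by (simp add: couplings_def)
    have "(\<integral>\<^sup>+ z. ennreal ((norm (n (snd z) - snd z))\<^sup>2) \<partial>\<gamma>) = (\<integral>\<^sup>+ y. ennreal ((norm (n y - y))\<^sup>2) \<partial>distr \<gamma> borel snd)"
      by (simp add: nn_integral_distr)
    also have "\<dots> = (\<integral>\<^sup>+ y. ennreal ((norm (n y - y))\<^sup>2) \<partial>?\<eta>)"
      using \<gamma> by (simp add: couplings_def)
    also have "\<dots> = (\<integral>\<^sup>+ \<omega>. ennreal ((norm (n (Y \<omega>) - Y \<omega>))\<^sup>2) \<partial>M)"
      by (simp add: nn_integral_distr)
    also have "\<dots> = (\<integral>\<^sup>+ \<omega>. ennreal ((norm (X \<omega> - Y \<omega>))\<^sup>2) \<partial>M)"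
      by (intro nn_integral_cong) (simp add: n)
    also have "\<dots> = transport_cost ?J"
      unfolding transport_cost_def by (simp add: nn_integral_distr case_prod_unfold)
    finally show ?thesis .
  qed
  have lower: "transport_cost ?J \<le> transport_cost \<gamma>" if \<gamma>: "\<gamma> \<in> couplings ?\<rho> ?\<eta>" for \<gamma>
  proof -
    have "(\<integral>\<^sup>+ z. ennreal ((norm (n (snd z) - snd z))\<^sup>2) \<partial>\<gamma>)
        \<le> (\<integral>\<^sup>+ z. ennreal ((norm (fst z - snd z))\<^sup>2) \<partial>\<gamma>)"
      using fst_le[OF \<gamma>] by (intro nn_integral_mono_AE) (auto intro!: ennreal_leI power_mono)
    then show ?thesis unfolding cost_n[OF \<gamma>] by (simp add: transport_cost_def case_prod_unfold)
  qed
  have J: "?J \<in> couplings ?\<rho> ?\<eta>" by (intro joint_law_in_couplings) simp_all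
  have inf: "(INF \<gamma>\<in>couplings ?\<rho> ?\<eta>. transport_cost \<gamma>) = transport_cost ?J"
    by (intro antisym INF_lower J INF_greatest lower)
  have unique: "\<gamma> = ?J" if opt: "\<gamma> \<in> optimal_couplings ?\<rho> ?\<eta>" for \<gamma>
  proof -
    have \<gamma>: "\<gamma> \<in> couplings ?\<rho> ?\<eta>" and cost: "transport_cost \<gamma> = transport_cost ?J"
      using opt inf by (simp_all add: optimal_couplings_def)
    have sets [measurable_cong]: "sets \<gamma> = sets borel" using \<gamma> by (simp add: couplings_def)
    \<comment> \<open>Finiteness permits subtraction in \<open>ennreal\<close>: for an optimal
      coupling the integrals of \<open>?f\<close> and of the smaller \<open>?g\<close> agree, hence
      \<open>?f = ?g\<close> almost everywhere.\<close>
    have fin: "transport_cost ?J \<noteq> \<infinity>" using transport_cost_joint_law[OF sq] by simp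
    let ?f = "\<lambda>z. ennreal ((norm (fst z - snd z))\<^sup>2)" and ?g = "\<lambda>z. ennreal ((norm (n (snd z) - snd z))\<^sup>2)"
    have "(\<integral>\<^sup>+ z. ?f z - ?g z \<partial>\<gamma>) = (\<integral>\<^sup>+ z. ?f z \<partial>\<gamma>) - (\<integral>\<^sup>+ z. ?g z \<partial>\<gamma>)"
      using fst_le[OF \<gamma>] fin
      by (intro nn_integral_diff) (auto simp: cost_n[OF \<gamma>] intro!: ennreal_leI power_mono)
    also have "(\<integral>\<^sup>+ z. ?f z \<partial>\<gamma>) = transport_cost ?J"
      using cost by (simp add: transport_cost_def case_prod_unfold)
    finally have "(\<integral>\<^sup>+ z. ?f z - ?g z \<partial>\<gamma>) = 0" using fin by (simp add: cost_n[OF \<gamma>])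
    then have "AE z in \<gamma>. ?f z - ?g z = 0" by (subst (asm) nn_integral_0_iff_AE) simp_all
    with fst_le[OF \<gamma>] have ae: "AE z in \<gamma>. z = (n (snd z), snd z)"
    proof eventually_elim
      case (elim z)
      then have "(norm (fst z - snd z))\<^sup>2 \<le> (norm (n (snd z) - snd z))\<^sup>2"
        by (simp add: ennreal_minus_if split: if_splits)
      then have "norm (fst z - snd z) \<le> norm (n (snd z) - snd z)" by (rule power2_le_imp_le) simp
      then show ?case using elim by (auto intro: prod_eqI)
    qed
    \<comment> \<open>The coupling is thus the image of its second marginal, the law of
      \<open>Y\<close>, under y -> (n y, y).\<close>
    have "\<gamma> = distr \<gamma> borel (\<lambda>z. z)" using sets by (simp add: distr_id2)
    also have "\<dots> = distr \<gamma> borel (\<lambda>z. (n (snd z), snd z))"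
      using ae by (intro distr_cong_AE) simp_all
    also have "\<dots> = distr (distr \<gamma> borel snd) borel (\<lambda>y. (n y, y))"
      by (simp add: distr_distr comp_def)
    also have "\<dots> = distr (distr M borel Y) borel (\<lambda>y. (n y, y))"
      using \<gamma> by (simp add: couplings_def)
    also have "\<dots> = distr M borel (\<lambda>\<omega>. (n (Y \<omega>), Y \<omega>))"
      by (simp add: distr_distr comp_def)
    also have "\<dots> = ?J" by (intro distr_cong) (simp_all add: n)
    finally show ?thesis .
  qed
  show ?thesis using unique J inf by (auto simp: optimal_couplings_def)
qed

section \<open>Functionals with Lipschitz Wasserstein gradient\<close>

locale lipschitz_gradient_functional =
  fixes F :: "'a::euclidean_space measure \<Rightarrow> real" and G :: "'a measure \<Rightarrow> 'a \<Rightarrow> 'a" and m L :: real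
  assumes L_nonneg: "0 \<le> L"
    and convex: "geodesically_convex m F"
    and expansion: "\<rho> \<in> P2 \<Longrightarrow> wasserstein_expansion F \<rho> (G \<rho>)"
    and lipschitz: "\<rho> \<in> P2 \<Longrightarrow> \<eta> \<in> P2 \<Longrightarrow> norm (G \<rho> x - G \<eta> y) \<le> L / 2 * (norm (x - y) + W2 \<rho> \<eta>)"
begin

lemma gradient_measurable:
  assumes "\<rho> \<in> P2"
  shows "G \<rho> \<in> borel_measurable borel"
proof -
  have "G \<rho> \<in> borel_measurable \<rho>"
    using expansion[OF assms] by (simp add: wasserstein_expansion_def L2_fields_def)
  then show ?thesis unfolding measurable_cong_sets[OF P2_D(2)[OF assms] refl] .
qed

lemma gradient_square_integrable:
  assumes "prob_space M" "square_integrable M X"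
  shows "square_integrable M (\<lambda>\<omega>. G (distr M borel X) (X \<omega>))"
proof -
  have P2: "distr M borel X \<in> P2" using assms by (rule distr_in_P2)
  have "square_integrable (distr M borel X) (G (distr M borel X))"
    using expansion[OF P2] by (simp add: square_integrable_def wasserstein_expansion_def L2_fields_def)
  then show ?thesis
    using assms(2) gradient_measurable[OF P2] by (subst (asm) square_integrable_distr) (auto simp: square_integrable_def)
qed

text \<open>The lifted gradient is \<open>L\<close>-Lipschitz in L^2, whatever the joint law of
  \<open>X\<close> and \<open>Y\<close>. The constant arises as (L/2)^2 from the hypothesis, a
  factor 2 from (a + b)^2 <= 2 (a^2 + b^2), and another 2 because W2^2 is at most E|X -
  Y|^2.\<close>

lemma gradient_mean_square_lipschitz:
  assumes M: "prob_space M" and sq: "square_integrable M X" "square_integrable M Y"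
  shows "mean_square M (\<lambda>\<omega>. G (distr M borel X) (X \<omega>) - G (distr M borel Y) (Y \<omega>))
    \<le> L\<^sup>2 * mean_square M (\<lambda>\<omega>. X \<omega> - Y \<omega>)"
proof -
  interpret prob_space M by fact
  let ?\<rho> = "distr M borel X" and ?\<eta> = "distr M borel Y"
  let ?d = "\<lambda>\<omega>. X \<omega> - Y \<omega>"
  have P2: "?\<rho> \<in> P2" "?\<eta> \<in> P2" using M sq by (simp_all add: distr_in_P2)
  have pointwise: "(norm (G ?\<rho> (X \<omega>) - G ?\<eta> (Y \<omega>)))\<^sup>2 \<le> L\<^sup>2 / 2 * ((norm (?d \<omega>))\<^sup>2 + (W2 ?\<rho> ?\<eta>)\<^sup>2)" for \<omega>
  proof -
    let ?a = "norm (?d \<omega>)" and ?b = "W2 ?\<rho> ?\<eta>"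
    have "(norm (G ?\<rho> (X \<omega>) - G ?\<eta> (Y \<omega>)))\<^sup>2 \<le> (L / 2 * (?a + ?b))\<^sup>2"
      by (intro power_mono lipschitz P2) simp
    also have "\<dots> = L\<^sup>2 / 4 * (?a + ?b)\<^sup>2" by (simp add: power_mult_distrib power_divide)
    also have "\<dots> \<le> L\<^sup>2 / 4 * (2 * (?a\<^sup>2 + ?b\<^sup>2))"
      using zero_le_power2[of "?a - ?b"]
      by (intro mult_left_mono) (simp_all add: power2_diff power2_sum del: zero_le_power2)
    also have "\<dots> = L\<^sup>2 / 2 * (?a\<^sup>2 + ?b\<^sup>2)" by simp
    finally show ?thesis .
  qed
  have "integrable M (\<lambda>\<omega>. (norm (?d \<omega>))\<^sup>2)"
    using sq by (intro square_integrable_norm_sq square_integrable_diff)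
  then have "integrable M (\<lambda>\<omega>. L\<^sup>2 / 2 * ((norm (?d \<omega>))\<^sup>2 + (W2 ?\<rho> ?\<eta>)\<^sup>2))"
    by (intro integrable_mult_right Bochner_Integration.integrable_add integrable_const)
  then have "mean_square M (\<lambda>\<omega>. G ?\<rho> (X \<omega>) - G ?\<eta> (Y \<omega>))
      \<le> (\<integral>\<omega>. L\<^sup>2 / 2 * ((norm (?d \<omega>))\<^sup>2 + (W2 ?\<rho> ?\<eta>)\<^sup>2) \<partial>M)"
    unfolding mean_square_def using sq M
    by (intro integral_mono pointwise square_integrable_norm_sq square_integrable_diff
        gradient_square_integrable)
  also have "\<dots> = L\<^sup>2 / 2 * (mean_square M ?d + (W2 ?\<rho> ?\<eta>)\<^sup>2)"
    using square_integrable_diff[OF sq]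
    by (simp add: mean_square_def square_integrable_norm_sq prob_space)
  also have "\<dots> \<le> L\<^sup>2 / 2 * (mean_square M ?d + mean_square M ?d)"
  proof -
    have "(W2 ?\<rho> ?\<eta>)\<^sup>2 \<le> (sqrt (mean_square M ?d))\<^sup>2"
      by (intro power_mono W2_distr_le sq) simp
    then show ?thesis by (intro mult_left_mono add_left_mono) simp_all
  qed
  finally show ?thesis by simp
qed

lemma expansion_remainder:
  assumes "\<rho> \<in> P2"
  shows "\<exists>\<gamma>. (\<forall>\<eta>\<in>P2. \<gamma> \<eta> \<in> optimal_couplings \<rho> \<eta>) \<and>
    (\<forall>c>0. \<forall>\<^sub>F \<eta> in inf (filtercomap (W2 \<rho>) (nhds 0)) (principal P2).
      \<bar>F \<eta> - F \<rho> - (\<integral>(x, y). G \<rho> x \<bullet> (y - x) \<partial>\<gamma> \<eta>)\<bar> \<le> c * W2 \<rho> \<eta>)"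
proof -
  obtain \<gamma> where \<gamma>: "\<forall>\<eta>\<in>P2. \<gamma> \<eta> \<in> optimal_couplings \<rho> \<eta>"
    "(\<lambda>\<eta>. F \<eta> - F \<rho> - (\<integral>(x, y). G \<rho> x \<bullet> (y - x) \<partial>\<gamma> \<eta>))
          \<in> o[inf (filtercomap (W2 \<rho>) (nhds 0)) (principal P2)](W2 \<rho>)"
    using expansion[OF assms] by (auto simp: wasserstein_expansion_def)
  show ?thesis
    using \<gamma>(1) landau_o.smallD[OF \<gamma>(2)] by auto
qed

text \<open>The target filter is the one along which the remainder of the Wasserstein expansion is
  small; the expansion can therefore be evaluated along random vectors converging in mean
  square.\<close>

lemma filterlim_distr_W2:
  assumes "prob_space M" "\<And>n. square_integrable M (X n)" "square_integrable M x"
    and lim: "((\<lambda>n. mean_square M (\<lambda>\<omega>. X n \<omega> - x \<omega>)) \<longlongrightarrow> 0) A"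
  shows "filterlim (\<lambda>n. distr M borel (X n))
    (inf (filtercomap (W2 (distr M borel x)) (nhds 0)) (principal P2)) A"
proof -
  have "((\<lambda>n. W2 (distr M borel x) (distr M borel (X n))) \<longlongrightarrow> 0) A"
  proof (rule Lim_null_comparison)
    show "((\<lambda>n. sqrt (mean_square M (\<lambda>\<omega>. X n \<omega> - x \<omega>))) \<longlongrightarrow> 0) A"
      using tendsto_real_sqrt[OF lim] by simp
    have "W2 (distr M borel x) (distr M borel (X n)) \<le> sqrt (mean_square M (\<lambda>\<omega>. X n \<omega> - x \<omega>))" for n
      using W2_distr_le[OF assms(3) assms(2)[of n]] by (simp add: mean_square_def norm_minus_commute)
    then show "\<forall>\<^sub>F n in A. norm (W2 (distr M borel x) (distr M borel (X n)))
        \<le> sqrt (mean_square M (\<lambda>\<omega>. X n \<omega> - x \<omega>))"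
      by simp
  qed
  then show ?thesis
    using assms(1,2) by (simp add: filterlim_inf filterlim_principal filterlim_filtercomap_iff comp_def distr_in_P2)
qed

text \<open>The expansion with remainder constant 1 gives |F \<eta> - F \<rho>| <= (K + 1) W2 near
  \<rho>, where K is the L^2 norm of the gradient at \<rho>.\<close>

lemma functional_continuous:
  assumes M: "prob_space M" and sq: "\<And>n. square_integrable M (X n)" "square_integrable M x"
    and lim: "((\<lambda>n. mean_square M (\<lambda>\<omega>. X n \<omega> - x \<omega>)) \<longlongrightarrow> 0) A"
  shows "((\<lambda>n. F (distr M borel (X n))) \<longlongrightarrow> F (distr M borel x)) A"
proof -
  let ?\<rho> = "distr M borel x" and ?\<eta> = "\<lambda>n. distr M borel (X n)"
  have \<rho>: "?\<rho> \<in> P2" and \<eta>: "?\<eta> n \<in> P2" for n using M sq by (simp_all add: distr_in_P2)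
  obtain \<gamma> where \<gamma>: "\<forall>\<eta>\<in>P2. \<gamma> \<eta> \<in> optimal_couplings ?\<rho> \<eta>"
    "\<forall>c>0. \<forall>\<^sub>F \<eta> in inf (filtercomap (W2 ?\<rho>) (nhds 0)) (principal P2).
      \<bar>F \<eta> - F ?\<rho> - (\<integral>(x, y). G ?\<rho> x \<bullet> (y - x) \<partial>\<gamma> \<eta>)\<bar> \<le> c * W2 ?\<rho> \<eta>"
    using expansion_remainder[OF \<rho>] by blast
  have opt: "\<gamma> (?\<eta> n) \<in> optimal_couplings ?\<rho> (?\<eta> n)" for n using \<gamma>(1) \<eta> by blast
  note flim = filterlim_distr_W2[OF M sq lim]
  let ?K = "sqrt (mean_square ?\<rho> (G ?\<rho>))"
  \<comment> \<open>The coupling selected by the expansion is unknown, but Cauchy-Schwarz bounds the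
    linear term in the same way for every optimal coupling.\<close>
  have linear: "\<bar>\<integral>(x, y). G ?\<rho> x \<bullet> (y - x) \<partial>\<gamma> (?\<eta> n)\<bar> \<le> ?K * W2 ?\<rho> (?\<eta> n)" for n
  proof -
    have c: "\<gamma> (?\<eta> n) \<in> couplings ?\<rho> (?\<eta> n)" using opt[of n] by (simp add: optimal_couplings_def)
    then have [measurable_cong]: "sets (\<gamma> (?\<eta> n)) = sets borel" and d: "distr (\<gamma> (?\<eta> n)) borel fst = ?\<rho>"
      by (simp_all add: couplings_def)
    note s = coupling_square_integrable[OF c \<rho> \<eta>]
    have "square_integrable (\<gamma> (?\<eta> n)) (\<lambda>z. G ?\<rho> (fst z))"
      using gradient_square_integrable[OF s(1,2)] unfolding d .
    moreover have "mean_square (\<gamma> (?\<eta> n)) (\<lambda>z. G ?\<rho> (fst z)) = mean_square ?\<rho> (G ?\<rho>)"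
      using mean_square_distr[of fst "\<gamma> (?\<eta> n)" "G ?\<rho>"] gradient_measurable[OF \<rho>] s(2)
      unfolding d by (simp add: square_integrable_def)
    ultimately show ?thesis
      using integral_Cauchy_Schwarz[OF _ square_integrable_diff[OF s(3,2)], of "\<lambda>z. G ?\<rho> (fst z)"]
      by (simp add: case_prod_unfold W2_eq_mean_square[OF opt \<rho> \<eta>])
  qed
  have "((\<lambda>n. F (?\<eta> n) - F ?\<rho>) \<longlongrightarrow> 0) A"
  proof (rule Lim_null_comparison)
    show "\<forall>\<^sub>F n in A. norm (F (?\<eta> n) - F ?\<rho>) \<le> (?K + 1) * W2 ?\<rho> (?\<eta> n)"
      using eventually_compose_filterlim[OF \<gamma>(2)[rule_format, OF zero_less_one] flim]
    proof eventually_elim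
      case (elim n)
      then show ?case using linear[of n] by (simp add: algebra_simps abs_le_iff)
    qed
    have "((\<lambda>n. W2 ?\<rho> (?\<eta> n)) \<longlongrightarrow> 0) A"
      using flim by (simp add: filterlim_inf filterlim_filtercomap_iff comp_def)
    then show "((\<lambda>n. (?K + 1) * W2 ?\<rho> (?\<eta> n)) \<longlongrightarrow> 0) A"
      by (rule tendsto_mult_right_zero)
  qed
  then show ?thesis by (rule Lim_null[THEN iffD2])
qed

end

section \<open>Quadratic bounds along straight segments of random vectors\<close>

text \<open>For two atoms of (X, Y) with distinct positions at time \<open>t\<close>, the strict
  inequality holds at \<open>r = t\<close> and persists nearby by continuity; there are finitely
  many pairs. Atoms whose trajectories meet at time \<open>t\<close> are exempt, so crossings are
  allowed.\<close>

lemma nearest_along_segment: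
  fixes X Y :: "'b \<Rightarrow> 'a::euclidean_space"
  assumes "simple_function M X" "simple_function M Y"
  defines "Z \<equiv> \<lambda>t \<omega>. (1 - t) *\<^sub>R X \<omega> + t *\<^sub>R Y \<omega>"
  shows "\<forall>\<^sub>F r in nhds t. \<forall>\<omega>\<in>space M. \<forall>\<omega>'\<in>space M. Z t \<omega> \<noteq> Z t \<omega>' \<longrightarrow>
    norm (Z t \<omega> - Z r \<omega>) < norm (Z t \<omega>' - Z r \<omega>)"
proof -
  define P where "P = (\<lambda>\<omega>. (X \<omega>, Y \<omega>)) ` space M"
  define z where "z t p = (1 - t) *\<^sub>R fst p + t *\<^sub>R snd p" for t and p :: "'a \<times> 'a"
  have fin: "finite P" unfolding P_def
    using assms(1,2) by (intro simple_functionD(1) simple_function_Pair)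
  have "\<forall>\<^sub>F r in nhds t. z t p \<noteq> z t q \<longrightarrow> norm (z t p - z r p) < norm (z t q - z r p)" for p q
  proof (cases "z t p = z t q")
    case False
    have "((\<lambda>r. norm (z t q - z r p) - norm (z t p - z r p)) \<longlongrightarrow> norm (z t q - z t p) - norm (z t p - z t p)) (nhds t)"
      unfolding z_def by (intro tendsto_intros filterlim_ident)
    then have "\<forall>\<^sub>F r in nhds t. 0 < norm (z t q - z r p) - norm (z t p - z r p)"
      by (rule order_tendstoD) (use False in simp)
    then show ?thesis by eventually_elim simp
  qed simp
  then have "\<forall>\<^sub>F r in nhds t. \<forall>p\<in>P. \<forall>q\<in>P. z t p \<noteq> z t q \<longrightarrow> norm (z t p - z r p) < norm (z t q - z r p)"
    using fin by (intro eventually_ball_finite ballI) auto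
  then show ?thesis
    by eventually_elim (simp add: P_def z_def Z_def)
qed

context lipschitz_gradient_functional
begin

text \<open>The calculus lemma is applied to \<open>\<phi> t\<close>, the value of \<open>F\<close>
  at the law of \<open>Z t\<close>, with \<open>K = m * D\<close> and \<open>C = L * D\<close>. Its
  derivative and convexity hypotheses hold because for \<open>r\<close> near \<open>t\<close> the
  joint law of (Z t, Z r) is the only optimal coupling.\<close>

lemma simple_two_sided_bound:
  fixes X Y :: "'b \<Rightarrow> 'a"
  assumes M: "prob_space M" and sX: "simple_function M X" and sY: "simple_function M Y"
  defines "D \<equiv> mean_square M (\<lambda>\<omega>. Y \<omega> - X \<omega>)"
    and "R \<equiv> F (distr M borel Y) - F (distr M borel X) - (\<integral>\<omega>. G (distr M borel X) (X \<omega>) \<bullet> (Y \<omega> - X \<omega>) \<partial>M)"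
  shows "m / 2 * D \<le> R" "R \<le> L / 2 * D"
proof -
  interpret prob_space M by fact
  note sqX = simple_function_square_integrable[OF M sX] and sqY = simple_function_square_integrable[OF M sY]
  define Z where "Z t \<omega> = (1 - t) *\<^sub>R X \<omega> + t *\<^sub>R Y \<omega>" for t \<omega>
  define \<phi> where "\<phi> t = F (distr M borel (Z t))" for t
  define g where "g t = (\<integral>\<omega>. G (distr M borel (Z t)) (Z t \<omega>) \<bullet> (Y \<omega> - X \<omega>) \<partial>M)" for t
  have sZ: "simple_function M (Z t)" for t
    unfolding Z_def using sX sY by (intro simple_function_add simple_function_scaleR) simp_all
  have sqZ: "square_integrable M (Z t)" for t by (rule simple_function_square_integrable[OF M sZ])
  then have [measurable]: "Z t \<in> borel_measurable M" for t by (simp add: square_integrable_def)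
  have P2: "distr M borel (Z t) \<in> P2" for t using M sqZ by (rule distr_in_P2)
  have Z_diff: "Z r \<omega> - Z t \<omega> = (r - t) *\<^sub>R (Y \<omega> - X \<omega>)" for r t \<omega>
    by (simp add: Z_def algebra_simps)
  then have ms: "mean_square M (\<lambda>\<omega>. Z r \<omega> - Z t \<omega>) = (r - t)\<^sup>2 * D" for r t
    by (simp add: D_def mean_square_scaleR)
  have ms0: "((\<lambda>r. mean_square M (\<lambda>\<omega>. Z r \<omega> - Z t \<omega>)) \<longlongrightarrow> 0) (at t)" for t
    unfolding ms by (auto intro!: tendsto_eq_intros)
  have near: "\<forall>\<^sub>F r in nhds t. optimal_couplings (distr M borel (Z t)) (distr M borel (Z r))
      = {distr M borel (\<lambda>\<omega>. (Z t \<omega>, Z r \<omega>))}" for t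
    using nearest_along_segment[OF sX sY, of t, folded Z_def]
  proof eventually_elim
    case (elim r)
    then show ?case by (intro unique_optimal_coupling M sZ) blast
  qed
  have W2: "W2 (distr M borel (Z t)) (distr M borel (Z r)) = \<bar>r - t\<bar> * sqrt D"
    if "optimal_couplings (distr M borel (Z t)) (distr M borel (Z r)) = {distr M borel (\<lambda>\<omega>. (Z t \<omega>, Z r \<omega>))}"
    for t r
  proof -
    have "W2 (distr M borel (Z t)) (distr M borel (Z r)) = sqrt (mean_square M (\<lambda>\<omega>. Z t \<omega> - Z r \<omega>))"
      using that by (subst W2_eq_transport_cost) (auto simp: transport_cost_joint_law[OF sqZ sqZ])
    then show ?thesis by (simp add: ms real_sqrt_mult abs_minus_commute)
  qed
  have deriv: "(\<phi> has_real_derivative g t) (at t)" for t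
  proof -
    let ?\<rho> = "distr M borel (Z t)" and ?\<eta> = "\<lambda>r. distr M borel (Z r)"
    obtain \<gamma> where \<gamma>: "\<forall>\<eta>\<in>P2. \<gamma> \<eta> \<in> optimal_couplings ?\<rho> \<eta>"
      "\<forall>c>0. \<forall>\<^sub>F \<eta> in inf (filtercomap (W2 ?\<rho>) (nhds 0)) (principal P2).
        \<bar>F \<eta> - F ?\<rho> - (\<integral>(x, y). G ?\<rho> x \<bullet> (y - x) \<partial>\<gamma> \<eta>)\<bar> \<le> c * W2 ?\<rho> \<eta>"
      using expansion_remainder[OF P2[of t]] by blast
    note flim = filterlim_distr_W2[OF M sqZ sqZ ms0[of t]]
    have near_t: "\<forall>\<^sub>F r in at t. optimal_couplings ?\<rho> (?\<eta> r) = {distr M borel (\<lambda>\<omega>. (Z t \<omega>, Z r \<omega>))}"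
      by (rule filter_leD[OF at_within_le_nhds near])
    have "((\<lambda>r. (\<phi> r - \<phi> t) / (r - t)) \<longlongrightarrow> g t) (at t)"
    proof (rule tendstoI)
      fix e :: real assume "e > 0"
      \<comment> \<open>The summand 1 keeps the denominator positive when \<open>D = 0\<close>, and
        it makes \<open>c * sqrt D < e\<close> strict.\<close>
      define c where "c = e / (sqrt D + 1)"
      have "0 < sqrt D + 1" by (simp add: D_def add_nonneg_pos)
      then have c: "c > 0" "c * (sqrt D + 1) = e" using \<open>e > 0\<close> by (simp_all add: c_def)
      then have c_less: "c * sqrt D < e" by (simp add: algebra_simps)
      have "\<forall>\<^sub>F r in at t. \<bar>F (?\<eta> r) - F ?\<rho> - (\<integral>(x, y). G ?\<rho> x \<bullet> (y - x) \<partial>\<gamma> (?\<eta> r))\<bar> \<le> c * W2 ?\<rho> (?\<eta> r)"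
        using \<gamma>(2) c(1) flim by (intro eventually_compose_filterlim[OF _ flim]) blast
      moreover have "\<forall>\<^sub>F r in at t. r \<noteq> t" by (simp add: eventually_at_filter)
      ultimately show "\<forall>\<^sub>F r in at t. dist ((\<phi> r - \<phi> t) / (r - t)) (g t) < e"
        using near_t
      proof eventually_elim
        case (elim r)
        \<comment> \<open>Uniqueness identifies the coupling selected by the expansion, so its
          linear term becomes an integral over \<open>M\<close>.\<close>
        have "\<gamma> (?\<eta> r) = distr M borel (\<lambda>\<omega>. (Z t \<omega>, Z r \<omega>))" using \<gamma>(1) P2[of r] elim(3) by auto
        then have "(\<integral>(x, y). G ?\<rho> x \<bullet> (y - x) \<partial>\<gamma> (?\<eta> r)) = (\<integral>\<omega>. G ?\<rho> (Z t \<omega>) \<bullet> (Z r \<omega> - Z t \<omega>) \<partial>M)"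
          using gradient_measurable[OF P2[of t]] by (simp add: integral_distr case_prod_unfold)
        also have "\<dots> = (r - t) * g t" unfolding Z_diff g_def by simp
        finally have "\<bar>\<phi> r - \<phi> t - (r - t) * g t\<bar> \<le> c * (\<bar>r - t\<bar> * sqrt D)"
          using elim(1) W2[OF elim(3)] by (simp add: \<phi>_def)
        also have "\<dots> < \<bar>r - t\<bar> * e" using c_less elim(2) by (simp add: mult.left_commute)
        finally have "\<bar>\<phi> r - \<phi> t - (r - t) * g t\<bar> / \<bar>r - t\<bar> < e"
          using elim(2) by (simp add: pos_divide_less_eq mult.commute)
        also have "\<bar>\<phi> r - \<phi> t - (r - t) * g t\<bar> / \<bar>r - t\<bar> = \<bar>(\<phi> r - \<phi> t) / (r - t) - g t\<bar>"
          using elim(2) by (simp add: abs_divide[symmetric] diff_divide_distrib)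
        finally show ?case by (simp add: dist_real_def)
      qed
    qed
    then show ?thesis by (simp add: has_field_derivative_iff)
  qed
  have conv: "\<forall>\<^sub>F r in at_right t. \<forall>u\<in>{0..1}. \<phi> ((1 - u) * t + u * r)
      \<le> (1 - u) * \<phi> t + u * \<phi> r - (m * D) * (r - t)\<^sup>2 / 2 * u * (1 - u)" for t
    using filter_leD[OF at_within_le_nhds near[of t]]
  proof eventually_elim
    case (elim r)
    show ?case
    proof
      fix u :: real assume u: "u \<in> {0..1}"
      let ?J = "distr M borel (\<lambda>\<omega>. (Z t \<omega>, Z r \<omega>))"
      \<comment> \<open>Interpolating between two points of a segment stays on the segment, so the
        Wasserstein interpolant is again the law of some \<open>Z\<close>.\<close>
      have "(\<lambda>\<omega>. (1 - u) *\<^sub>R Z t \<omega> + u *\<^sub>R Z r \<omega>) = Z ((1 - u) * t + u * r)"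
        by (rule ext) (simp add: Z_def algebra_simps)
      then have "distr ?J borel (\<lambda>(x, y). (1 - u) *\<^sub>R x + u *\<^sub>R y) = distr M borel (Z ((1 - u) * t + u * r))"
        by (simp add: distr_distr comp_def case_prod_unfold)
      moreover have "F (distr ?J borel (\<lambda>(x, y). (1 - u) *\<^sub>R x + u *\<^sub>R y))
          \<le> (1 - u) * \<phi> t + u * \<phi> r - m / 2 * u * (1 - u) * (W2 (distr M borel (Z t)) (distr M borel (Z r)))\<^sup>2"
        using convex P2 elim u unfolding geodesically_convex_def \<phi>_def by blast
      moreover have "(W2 (distr M borel (Z t)) (distr M borel (Z r)))\<^sup>2 = (r - t)\<^sup>2 * D"
        unfolding W2[OF elim] by (simp add: power_mult_distrib D_def)
      ultimately show "\<phi> ((1 - u) * t + u * r)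
          \<le> (1 - u) * \<phi> t + u * \<phi> r - (m * D) * (r - t)\<^sup>2 / 2 * u * (1 - u)"
        by (simp add: \<phi>_def mult_ac)
    qed
  qed
  have lip: "\<bar>g t - g r\<bar> \<le> (L * D) * \<bar>t - r\<bar>" for t r
  proof -
    let ?U = "\<lambda>t \<omega>. G (distr M borel (Z t)) (Z t \<omega>)" and ?V = "\<lambda>\<omega>. Y \<omega> - X \<omega>"
    have sqU: "square_integrable M (?U t)" for t by (rule gradient_square_integrable[OF M sqZ])
    have sqV: "square_integrable M ?V" using sqX sqY by (intro square_integrable_diff)
    have "g t - g r = (\<integral>\<omega>. ?U t \<omega> \<bullet> ?V \<omega> - ?U r \<omega> \<bullet> ?V \<omega> \<partial>M)"
      unfolding g_def by (intro Bochner_Integration.integral_diff[symmetric] square_integrable_inner sqU sqV)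
    also have "\<dots> = (\<integral>\<omega>. (?U t \<omega> - ?U r \<omega>) \<bullet> ?V \<omega> \<partial>M)" by (simp add: inner_diff_left)
    finally have "\<bar>g t - g r\<bar> \<le> sqrt (mean_square M (\<lambda>\<omega>. ?U t \<omega> - ?U r \<omega>)) * sqrt (mean_square M ?V)"
      using integral_Cauchy_Schwarz[OF square_integrable_diff[OF sqU sqU] sqV] by simp
    also have "\<dots> \<le> sqrt (L\<^sup>2 * ((t - r)\<^sup>2 * D)) * sqrt D"
      using gradient_mean_square_lipschitz[OF M sqZ sqZ, of t r]
      unfolding ms D_def by (intro mult_right_mono real_sqrt_le_mono) simp_all
    also have "\<dots> = (L * D) * \<bar>t - r\<bar>"
      using L_nonneg by (simp add: real_sqrt_mult D_def)
    finally show ?thesis .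
  qed
  have ends: "Z 0 = X" "Z 1 = Y" by (simp_all add: Z_def fun_eq_iff)
  have "R = \<phi> 1 - \<phi> 0 - g 0" by (simp add: R_def \<phi>_def g_def ends)
  then show "m / 2 * D \<le> R" "R \<le> L / 2 * D"
    using two_sided_quadratic_bound[OF deriv conv lip] by simp_all
qed

text \<open>Simple approximations of \<open>X\<close> and \<open>Y\<close> on the same space
  converge jointly in mean square, and every term of the inequality is continuous for that
  convergence. No optimality of the joint law is required of (X, Y), so the bounds hold along every
  coupling.\<close>

lemma two_sided_bound:
  fixes X Y :: "'b \<Rightarrow> 'a"
  assumes M: "prob_space M" and sq: "square_integrable M X" "square_integrable M Y"
  defines "D \<equiv> mean_square M (\<lambda>\<omega>. Y \<omega> - X \<omega>)"
    and "R \<equiv> F (distr M borel Y) - F (distr M borel X) - (\<integral>\<omega>. G (distr M borel X) (X \<omega>) \<bullet> (Y \<omega> - X \<omega>) \<partial>M)"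
  shows "m / 2 * D \<le> R" "R \<le> L / 2 * D"
proof -
  obtain S where S: "\<And>n. simple_function M (S n)" "(\<lambda>n. mean_square M (\<lambda>\<omega>. S n \<omega> - X \<omega>)) \<longlonglongrightarrow> 0"
    by (rule square_integrable_simple_approximation[OF sq(1) M]) blast
  obtain T where T: "\<And>n. simple_function M (T n)" "(\<lambda>n. mean_square M (\<lambda>\<omega>. T n \<omega> - Y \<omega>)) \<longlonglongrightarrow> 0"
    by (rule square_integrable_simple_approximation[OF sq(2) M]) blast
  note sqS = simple_function_square_integrable[OF M S(1)] and sqT = simple_function_square_integrable[OF M T(1)]
  define d where "d n = mean_square M (\<lambda>\<omega>. T n \<omega> - S n \<omega>)" for n
  define \<delta> where "\<delta> n = F (distr M borel (T n)) - F (distr M borel (S n))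
    - (\<integral>\<omega>. G (distr M borel (S n)) (S n \<omega>) \<bullet> (T n \<omega> - S n \<omega>) \<partial>M)" for n
  have diff: "(\<lambda>n. mean_square M (\<lambda>\<omega>. (T n \<omega> - S n \<omega>) - (Y \<omega> - X \<omega>))) \<longlonglongrightarrow> 0"
  proof (rule tendsto_sandwich[OF _ _ tendsto_const])
    show "(\<lambda>n. 2 * mean_square M (\<lambda>\<omega>. T n \<omega> - Y \<omega>) + 2 * mean_square M (\<lambda>\<omega>. S n \<omega> - X \<omega>)) \<longlonglongrightarrow> 0"
      by (auto intro!: tendsto_eq_intros S(2) T(2))
    have "mean_square M (\<lambda>\<omega>. (T n \<omega> - S n \<omega>) - (Y \<omega> - X \<omega>))
        \<le> 2 * mean_square M (\<lambda>\<omega>. T n \<omega> - Y \<omega>) + 2 * mean_square M (\<lambda>\<omega>. S n \<omega> - X \<omega>)" for n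
    proof -
      have i: "integrable M (\<lambda>\<omega>. 2 * (norm (T n \<omega> - Y \<omega>))\<^sup>2)" "integrable M (\<lambda>\<omega>. 2 * (norm (S n \<omega> - X \<omega>))\<^sup>2)"
        using sq sqS[of n] sqT[of n]
        by (auto intro!: integrable_mult_right square_integrable_norm_sq square_integrable_diff)
      have "mean_square M (\<lambda>\<omega>. (T n \<omega> - S n \<omega>) - (Y \<omega> - X \<omega>))
        \<le> (\<integral>\<omega>. 2 * (norm (T n \<omega> - Y \<omega>))\<^sup>2 + 2 * (norm (S n \<omega> - X \<omega>))\<^sup>2 \<partial>M)"
        unfolding mean_square_def
      proof (rule integral_mono)
        show "integrable M (\<lambda>\<omega>. (norm ((T n \<omega> - S n \<omega>) - (Y \<omega> - X \<omega>)))\<^sup>2)"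
          using sq sqS[of n] sqT[of n] by (intro square_integrable_norm_sq square_integrable_diff)
        fix \<omega>
        have "norm ((T n \<omega> - S n \<omega>) - (Y \<omega> - X \<omega>)) \<le> norm (T n \<omega> - Y \<omega>) + norm (S n \<omega> - X \<omega>)"
          using norm_triangle_ineq4[of "T n \<omega> - Y \<omega>" "S n \<omega> - X \<omega>"] by (simp add: algebra_simps)
        then have "(norm ((T n \<omega> - S n \<omega>) - (Y \<omega> - X \<omega>)))\<^sup>2 \<le> (norm (T n \<omega> - Y \<omega>) + norm (S n \<omega> - X \<omega>))\<^sup>2"
          by (intro power_mono) auto
        also have "\<dots> \<le> 2 * (norm (T n \<omega> - Y \<omega>))\<^sup>2 + 2 * (norm (S n \<omega> - X \<omega>))\<^sup>2"
          using zero_le_power2[of "norm (T n \<omega> - Y \<omega>) - norm (S n \<omega> - X \<omega>)"]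
          by (simp add: power2_diff power2_sum del: zero_le_power2)
        finally show "(norm ((T n \<omega> - S n \<omega>) - (Y \<omega> - X \<omega>)))\<^sup>2
            \<le> 2 * (norm (T n \<omega> - Y \<omega>))\<^sup>2 + 2 * (norm (S n \<omega> - X \<omega>))\<^sup>2" .
      qed (use i in simp)
      then show ?thesis using i by (simp add: mean_square_def)
    qed
    then show "\<forall>\<^sub>F n in sequentially. mean_square M (\<lambda>\<omega>. (T n \<omega> - S n \<omega>) - (Y \<omega> - X \<omega>))
        \<le> 2 * mean_square M (\<lambda>\<omega>. T n \<omega> - Y \<omega>) + 2 * mean_square M (\<lambda>\<omega>. S n \<omega> - X \<omega>)"
      by simp
  qed simp
  have grad: "(\<lambda>n. mean_square M (\<lambda>\<omega>. G (distr M borel (S n)) (S n \<omega>) - G (distr M borel X) (X \<omega>))) \<longlonglongrightarrow> 0"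
  proof (rule tendsto_sandwich[OF _ _ tendsto_const])
    show "(\<lambda>n. L\<^sup>2 * mean_square M (\<lambda>\<omega>. S n \<omega> - X \<omega>)) \<longlonglongrightarrow> 0"
      by (auto intro!: tendsto_eq_intros S(2))
  qed (use gradient_mean_square_lipschitz[OF M sqS sq(1)] in simp_all)
  have sqd: "square_integrable M (\<lambda>\<omega>. T n \<omega> - S n \<omega>)" "square_integrable M (\<lambda>\<omega>. Y \<omega> - X \<omega>)" for n
    by (intro square_integrable_diff sqS sqT sq)+
  have d_lim: "d \<longlonglongrightarrow> D"
    using tendsto_integral_inner[OF sqd(1) sqd(1) sqd(2) sqd(2) diff diff]
    by (simp add: d_def[abs_def] D_def mean_square_def power2_norm_eq_inner)
  \<comment> \<open>The values of \<open>F\<close> converge by continuity of the functional; the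
    pairing converges because both the lifted gradients and the displacements do.\<close>
  have \<delta>_lim: "\<delta> \<longlonglongrightarrow> R"
    unfolding \<delta>_def[abs_def] R_def
    by (intro tendsto_diff functional_continuous[OF M sqT sq(2) T(2)] functional_continuous[OF M sqS sq(1) S(2)]
        tendsto_integral_inner[OF _ sqd(1) _ sqd(2) grad diff] gradient_square_integrable M sqS sq)
  have bounds: "m / 2 * d n \<le> \<delta> n" "\<delta> n \<le> L / 2 * d n" for n
    unfolding d_def \<delta>_def by (rule simple_two_sided_bound[OF M S(1) T(1)])+
  show "m / 2 * D \<le> R"
    by (rule LIMSEQ_le[OF tendsto_mult_left[OF d_lim] \<delta>_lim]) (use bounds in blast)
  show "R \<le> L / 2 * D"
    by (rule LIMSEQ_le[OF \<delta>_lim tendsto_mult_left[OF d_lim]]) (use bounds in blast)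
qed

end

section \<open>Lyapunov analysis of the heavy-ball iteration\<close>

text \<open>The scalar part of the Lyapunov step. There \<open>\<Delta>\<close> is the optimality
  gap at the new position y, \<open>V\<close> and \<open>W\<close> are the mean squares of the new
  velocity and of the new combined vector, \<open>D\<close> is E|y - xs|^2, \<open>P\<close> is the
  pairing of the gradient with y - xs, and \<open>N\<close> is \<open>h\<^sup>2\<close> times the
  mean square of the gradient. After inserting the bounds on \<open>P\<close>, \<open>N\<close> and
  \<open>W\<close>, the coefficients of \<open>\<Delta>\<close>, \<open>V\<close> and
  \<open>D\<close> are compared separately.\<close>

lemma heavy_ball_decrease_arith:
  fixes q c A m :: real
  assumes q: "0 < q" "q < 1" and c: "c * (1 - q) = 1" and A: "A = (1 + q) * c" and m: "0 < m"
    and nonneg: "0 \<le> \<Delta>" "0 \<le> V" "0 \<le> D"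
    and P: "\<Delta> + m / 2 * D \<le> P" and N: "N \<le> q * \<Delta> / 2" and W: "W \<le> 2 * A\<^sup>2 * V + 8 * m * c\<^sup>2 * D"
  shows "q / 4 * (A * \<Delta> + V / 4 + W / 4) \<le> (A\<^sup>2 - 1) / 4 * V + q * c * A * P - A\<^sup>2 / 2 * N"
proof -
  have c0: "0 < c" using c q by (metis diff_gt_0_iff_gt zero_less_mult_pos2 zero_less_one)
  then have A0: "0 < A" using q by (simp add: A)
  have c2: "c\<^sup>2 * (1 - q)\<^sup>2 = 1" using c by (metis one_power2 power_mult_distrib)
  have "(A\<^sup>2 - 1) / 4 = (c\<^sup>2 * (1 + q)\<^sup>2 - c\<^sup>2 * (1 - q)\<^sup>2) / 4"
    by (simp add: c2 A power_mult_distrib mult.commute)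
  \<comment> \<open>This is (1 + q)^2 - (1 - q)^2 = 4 q, scaled by \<open>c\<^sup>2\<close>.\<close>
  then have A2: "(A\<^sup>2 - 1) / 4 = q * c\<^sup>2" by (simp add: power2_eq_square algebra_simps)
  have P': "q * c * A * (\<Delta> + m / 2 * D) \<le> q * c * A * P"
    using P q c0 A0 by (intro mult_left_mono) auto
  have N': "A\<^sup>2 / 2 * N \<le> A\<^sup>2 / 2 * (q * \<Delta> / 2)"
    using N by (intro mult_left_mono) auto
  have W': "q / 16 * W \<le> q / 16 * (2 * A\<^sup>2 * V + 8 * m * c\<^sup>2 * D)"
    using W q by (intro mult_left_mono) auto
  have \<Delta>_coeff: "(q / 4 * A) * \<Delta> \<le> (q * c * A - A\<^sup>2 * q / 4) * \<Delta>"
  proof (rule mult_right_mono)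
    \<comment> \<open>Writing 1 as c (1 - q) makes all terms multiples of c, and half of
      \<open>q * A * c\<close> is left over.\<close>
    have "q * c * A - A\<^sup>2 * q / 4 - q / 4 * A = q * A * (c - (1 + q) * c / 4 - c * (1 - q) / 4)"
      unfolding c by (simp add: A power2_eq_square algebra_simps)
    also have "\<dots> = q * A * c / 2" by (simp add: field_simps)
    also have "\<dots> \<ge> 0" using q A0 c0 by simp
    finally show "q / 4 * A \<le> q * c * A - A\<^sup>2 * q / 4" by simp
  qed (use nonneg in simp)
  \<comment> \<open>With (1 - q)^2 <= 2 and (1 + q)^2 <= 4 the left side is at most (1/8 + 1/2) q
    c^2.\<close>
  have V_coeff: "(q / 16 + q / 8 * A\<^sup>2) * V \<le> (q * c\<^sup>2) * V"
  proof (rule mult_right_mono)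
    have "q\<^sup>2 \<le> 1" using q by (simp add: power_le_one)
    then have "(1 - q)\<^sup>2 \<le> 2" "(1 + q)\<^sup>2 \<le> 4" using q by (simp_all add: power2_sum power2_diff)
    then have "q / 16 * (c\<^sup>2 * (1 - q)\<^sup>2) + q / 8 * (c\<^sup>2 * (1 + q)\<^sup>2)
        \<le> q / 16 * (c\<^sup>2 * 2) + q / 8 * (c\<^sup>2 * 4)"
      using q by (intro add_mono mult_left_mono) auto
    also have "\<dots> \<le> q * c\<^sup>2" using q by simp
    finally show "q / 16 + q / 8 * A\<^sup>2 \<le> q * c\<^sup>2"
      unfolding c2 by (simp add: A power_mult_distrib mult.commute)
  qed (use nonneg in simp)
  have D_coeff: "(q / 2 * m * c\<^sup>2) * D \<le> (q * c * A * (m / 2)) * D"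
  proof (rule mult_right_mono)
    have "q / 2 * m * c\<^sup>2 * 1 \<le> q / 2 * m * c\<^sup>2 * (1 + q)"
      using q m by (intro mult_left_mono) auto
    then show "q / 2 * m * c\<^sup>2 \<le> q * c * A * (m / 2)"
      by (simp add: A power2_eq_square mult_ac)
  qed (use nonneg in simp)
  have "q / 4 * (A * \<Delta> + V / 4 + W / 4) = (q / 4 * A) * \<Delta> + q / 16 * V + q / 16 * W"
    by (simp add: algebra_simps)
  also have "\<dots> \<le> (q / 4 * A) * \<Delta> + (q / 16 + q / 8 * A\<^sup>2) * V + (q / 2 * m * c\<^sup>2) * D"
    using W' by (simp add: algebra_simps)
  also have "\<dots> \<le> (q * c * A - A\<^sup>2 * q / 4) * \<Delta> + (q * c\<^sup>2) * V + (q * c * A * (m / 2)) * D"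
    by (intro add_mono \<Delta>_coeff V_coeff D_coeff)
  also have "\<dots> = (A\<^sup>2 - 1) / 4 * V + q * c * A * (\<Delta> + m / 2 * D) - A\<^sup>2 / 2 * (q * \<Delta> / 2)"
    unfolding A2 by (simp add: algebra_simps)
  also have "\<dots> \<le> (A\<^sup>2 - 1) / 4 * V + q * c * A * P - A\<^sup>2 / 2 * N"
    using P' N' by linarith
  finally show ?thesis .
qed

text \<open>Drift and kick are realized on random vectors over a fixed space, so the whole iteration
  can be compared with one random vector having the law of a minimizer.\<close>

lemma hb_step_joint_law:
  fixes x v :: "'b \<Rightarrow> 'a::euclidean_space"
  assumes [measurable]: "x \<in> borel_measurable M" "v \<in> borel_measurable M"
    and "G (distr M borel (\<lambda>\<omega>. x \<omega> + sqrt s *\<^sub>R v \<omega>)) \<in> borel_measurable borel"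
  defines "y \<equiv> \<lambda>\<omega>. x \<omega> + sqrt s *\<^sub>R v \<omega>"
  shows "hb_kick G s \<beta> (hb_drift s (distr M borel (\<lambda>\<omega>. (x \<omega>, v \<omega>))))
    = distr M borel (\<lambda>\<omega>. (y \<omega>, \<beta> *\<^sub>R v \<omega> - sqrt s *\<^sub>R G (distr M borel y) (y \<omega>)))"
proof -
  have [measurable]: "y \<in> borel_measurable M" "G (distr M borel y) \<in> borel_measurable borel"
    using assms by (simp_all add: y_def)
  have drift: "hb_drift s (distr M borel (\<lambda>\<omega>. (x \<omega>, v \<omega>))) = distr M borel (\<lambda>\<omega>. (y \<omega>, v \<omega>))"
    by (simp add: hb_drift_def distr_distr comp_def y_def case_prod_unfold)
  have "distr (distr M borel (\<lambda>\<omega>. (y \<omega>, v \<omega>))) borel fst = distr M borel y"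
    by (simp add: distr_distr comp_def)
  then show ?thesis
    by (simp add: drift hb_kick_def distr_distr comp_def case_prod_unfold)
qed

context lipschitz_gradient_functional
begin

text \<open>The lower and upper quadratic bounds are compared for the constant random vectors 0 and
  a unit vector. This is what keeps q = m/(4L) below 1.\<close>

lemma modulus_le_lipschitz: "m \<le> L"
proof -
  obtain b :: 'a where b: "b \<in> Basis" using nonempty_Basis by blast
  let ?M = "return borel (0 :: real)"
  interpret prob_space ?M by (rule prob_space_return) simp
  have sq: "square_integrable ?M (\<lambda>_. 0 :: 'a)" "square_integrable ?M (\<lambda>_. b)"
    by (simp_all add: square_integrable_def)
  have "mean_square ?M (\<lambda>_. b - 0) = 1"
    using b prob_space by (simp add: mean_square_def)
  then show ?thesis
    using two_sided_bound[OF prob_space_axioms sq] by simp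
qed

text \<open>A gradient step of length 1/L lowers \<open>F\<close> by at least E|g|^2/(2L), and the
  value reached is still at least \<open>f\<close>.\<close>

lemma gradient_mean_square_le:
  assumes M: "prob_space M" and sq: "square_integrable M X"
    and L: "L > 0" and min: "\<And>\<rho>. \<rho> \<in> P2 \<Longrightarrow> f \<le> F \<rho>"
  shows "mean_square M (\<lambda>\<omega>. G (distr M borel X) (X \<omega>)) \<le> 2 * L * (F (distr M borel X) - f)"
proof -
  let ?g = "\<lambda>\<omega>. G (distr M borel X) (X \<omega>)"
  define Y where "Y \<omega> = X \<omega> - (1 / L) *\<^sub>R ?g \<omega>" for \<omega>
  have sg: "square_integrable M ?g" by (rule gradient_square_integrable[OF M sq])
  then have sY: "square_integrable M Y" unfolding Y_def using sq by (intro square_integrable_diff square_integrable_scaleR)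
  have diff: "Y \<omega> - X \<omega> = (- 1 / L) *\<^sub>R ?g \<omega>" for \<omega> by (simp add: Y_def)
  have "f \<le> F (distr M borel Y)" by (intro min distr_in_P2 M sY)
  also have "\<dots> \<le> F (distr M borel X) + (\<integral>\<omega>. ?g \<omega> \<bullet> (Y \<omega> - X \<omega>) \<partial>M) + L / 2 * mean_square M (\<lambda>\<omega>. Y \<omega> - X \<omega>)"
    using two_sided_bound(2)[OF M sq sY] by simp
  also have "(\<integral>\<omega>. ?g \<omega> \<bullet> (Y \<omega> - X \<omega>) \<partial>M) = - (mean_square M ?g / L)"
    unfolding diff by (simp add: mean_square_def power2_norm_eq_inner)
  also have "mean_square M (\<lambda>\<omega>. Y \<omega> - X \<omega>) = mean_square M ?g / L\<^sup>2"
    unfolding diff mean_square_scaleR by (simp add: power_divide)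
  finally have "f \<le> F (distr M borel X) - mean_square M ?g / (2 * L)"
    using L by (simp add: power2_eq_square)
  then show ?thesis using L by (simp add: field_simps)
qed

text \<open>Everything is expressed at the new state (y, u). The weights in \<open>E\<close> are
  such that the pairing of the gradient with the new velocity, whose sign is unknown,
  cancels.\<close>

lemma heavy_ball_lyapunov_step:
  fixes x v xs :: "'b \<Rightarrow> 'a" and f q :: real
  assumes M: "prob_space M" and sq: "square_integrable M x" "square_integrable M v" "square_integrable M xs"
    and m: "m > 0" and L: "L > 0"
    and min: "\<And>\<rho>. \<rho> \<in> P2 \<Longrightarrow> f \<le> F \<rho>" and xs: "F (distr M borel xs) = f"
    and q: "q = m / (4 * L)" and h: "h = q / sqrt m" and A: "A = (1 + q) / (1 - q)"
    and a: "a = 2 * sqrt m / (1 - q)"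
  defines "E \<equiv> \<lambda>x v. A * (F (distr M borel x) - f) + mean_square M v / 4
      + mean_square M (\<lambda>\<omega>. A *\<^sub>R v \<omega> + a *\<^sub>R (x \<omega> - xs \<omega>)) / 4"
    and "y \<equiv> \<lambda>\<omega>. x \<omega> + h *\<^sub>R v \<omega>"
  defines "u \<equiv> \<lambda>\<omega>. (1 / A) *\<^sub>R v \<omega> - h *\<^sub>R G (distr M borel y) (y \<omega>)"
  shows "(1 + q / 4) * E y u \<le> E x v"
proof -
  define c where "c = 1 / (1 - q)"
  have q01: "0 < q" "q < 1"
    using m L modulus_le_lipschitz by (simp_all add: q)
  then have c: "c * (1 - q) = 1" and A_c: "A = (1 + q) * c" and a_c: "a = 2 * sqrt m * c"
    by (simp_all add: c_def A a)
  have A0: "0 < A" using q01 by (simp add: A)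
  have h0: "0 < h" using q01 m by (simp add: h)
  have ha: "h * a = 2 * q * c" using m by (simp add: h a_c)
  \<comment> \<open>This ties \<open>a\<close> to the step size: A v + a (x - xs) equals v + a (y -
    xs), since the drift moves x by h v.\<close>
  have Aha: "A = 1 + a * h" using ha c by (simp add: A_c algebra_simps)
  have h2: "h\<^sup>2 = q / (4 * L)"
    using m L by (simp add: h power_divide) (simp add: q power2_eq_square)
  have a2: "a\<^sup>2 = 4 * m * c\<^sup>2" using m by (simp add: a_c power_mult_distrib)
  define g where "g \<omega> = G (distr M borel y) (y \<omega>)" for \<omega>
  define w where "w \<omega> = A *\<^sub>R u \<omega> + a *\<^sub>R (y \<omega> - xs \<omega>)" for \<omega>
  have sy: "square_integrable M y" unfolding y_def using sq by (intro square_integrable_intros)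
  have sg: "square_integrable M g" unfolding g_def by (rule gradient_square_integrable[OF M sy])
  have su: "square_integrable M u" unfolding u_def g_def[symmetric] using sq sg by (intro square_integrable_intros)
  have sw: "square_integrable M w" unfolding w_def using su sy sq by (intro square_integrable_intros)
  have sd: "square_integrable M (\<lambda>\<omega>. y \<omega> - xs \<omega>)" using sy sq by (intro square_integrable_intros)
  note int = square_integrable_norm_sq square_integrable_inner
  \<comment> \<open>Solving the kick for the old velocity. The old velocity and the old combined
    vector are \<open>A *\<^sub>R u\<close> and \<open>w\<close> shifted by the same vector
    \<open>(h * A) *\<^sub>R g\<close>.\<close>
  have v_eq: "v \<omega> = A *\<^sub>R u \<omega> + (h * A) *\<^sub>R g \<omega>" for \<omega>
    using A0 by (simp add: u_def g_def scaleR_diff_right)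
  have w_eq: "A *\<^sub>R v \<omega> + a *\<^sub>R (x \<omega> - xs \<omega>) = w \<omega> + (h * A) *\<^sub>R g \<omega>" for \<omega>
  proof -
    have "A *\<^sub>R v \<omega> + a *\<^sub>R (x \<omega> - xs \<omega>) = v \<omega> + a *\<^sub>R (y \<omega> - xs \<omega>)"
      by (simp add: Aha y_def algebra_simps)
    then show ?thesis by (simp add: v_eq w_def)
  qed
  have norm_sq: "(norm (p + r *\<^sub>R z))\<^sup>2 = (norm p)\<^sup>2 + 2 * r * (z \<bullet> p) + r\<^sup>2 * (norm z)\<^sup>2" for p z :: 'a and r
    by (simp only: power2_norm_eq_inner) (simp add: algebra_simps inner_commute power2_eq_square)
  define Q where "Q = (\<integral>\<omega>. g \<omega> \<bullet> u \<omega> \<partial>M)"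
  define P where "P = (\<integral>\<omega>. g \<omega> \<bullet> (y \<omega> - xs \<omega>) \<partial>M)"
  let ?N = "mean_square M g" and ?V = "mean_square M u" and ?W = "mean_square M w"
  let ?D = "mean_square M (\<lambda>\<omega>. y \<omega> - xs \<omega>)" and ?\<Delta> = "F (distr M borel y) - f"
  have V_eq: "mean_square M v = A\<^sup>2 * ?V + 2 * h * A\<^sup>2 * Q + h\<^sup>2 * A\<^sup>2 * ?N"
  proof -
    have "(norm (v \<omega>))\<^sup>2 = A\<^sup>2 * (norm (u \<omega>))\<^sup>2 + 2 * h * A\<^sup>2 * (g \<omega> \<bullet> u \<omega>) + h\<^sup>2 * A\<^sup>2 * (norm (g \<omega>))\<^sup>2" for \<omega>
      unfolding v_eq norm_sq by (simp add: power_mult_distrib) (simp add: power2_eq_square)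
    then show ?thesis using su sg by (simp add: mean_square_def Q_def int)
  qed
  have gw: "(\<integral>\<omega>. g \<omega> \<bullet> w \<omega> \<partial>M) = A * Q + a * P"
    using sg su sd by (simp add: w_def inner_add_right Q_def P_def int)
  have W_eq: "mean_square M (\<lambda>\<omega>. A *\<^sub>R v \<omega> + a *\<^sub>R (x \<omega> - xs \<omega>))
      = ?W + 2 * h * A * (A * Q + a * P) + h\<^sup>2 * A\<^sup>2 * ?N"
    using sw sg unfolding w_eq mean_square_def norm_sq gw[symmetric]
    by (simp add: int power_mult_distrib)
  have gv: "(\<integral>\<omega>. g \<omega> \<bullet> v \<omega> \<partial>M) = A * Q + h * A * ?N"
    using sg su unfolding v_eq
    by (simp add: inner_add_right Q_def mean_square_def int power2_norm_eq_inner[symmetric])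
  \<comment> \<open>Lower quadratic bound from y towards x = y - h v; the quadratic term is
    dropped.\<close>
  have x_lower: "F (distr M borel y) - h * (A * Q + h * A * ?N) \<le> F (distr M borel x)"
  proof -
    have "x \<omega> - y \<omega> = - h *\<^sub>R v \<omega>" for \<omega> by (simp add: y_def)
    then have "(\<integral>\<omega>. g \<omega> \<bullet> (x \<omega> - y \<omega>) \<partial>M) = - h * (A * Q + h * A * ?N)"
      by (simp add: gv)
    moreover have "0 \<le> m / 2 * mean_square M (\<lambda>\<omega>. x \<omega> - y \<omega>)" using m by simp
    ultimately show ?thesis
      using two_sided_bound(1)[OF M sy sq(1)] unfolding g_def[symmetric] by simp
  qed
  \<comment> \<open>The same bound from y towards the minimizer; here the quadratic term is kept, as
    it absorbs the distance in \<open>W_upper\<close>.\<close>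
  have P_lower: "?\<Delta> + m / 2 * ?D \<le> P"
  proof -
    have "(\<integral>\<omega>. g \<omega> \<bullet> (xs \<omega> - y \<omega>) \<partial>M) = (\<integral>\<omega>. - (g \<omega> \<bullet> (y \<omega> - xs \<omega>)) \<partial>M)"
      by (simp add: inner_diff_right)
    also have "\<dots> = - P" by (simp add: P_def)
    finally have "(\<integral>\<omega>. g \<omega> \<bullet> (xs \<omega> - y \<omega>) \<partial>M) = - P" .
    moreover have "mean_square M (\<lambda>\<omega>. xs \<omega> - y \<omega>) = ?D"
      by (simp add: mean_square_def norm_minus_commute)
    ultimately show ?thesis
      using two_sided_bound(1)[OF M sy sq(3)] xs unfolding g_def[symmetric] by simp
  qed
  have N_upper: "h\<^sup>2 * ?N \<le> q * ?\<Delta> / 2"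
  proof -
    have "h\<^sup>2 * ?N \<le> h\<^sup>2 * (2 * L * ?\<Delta>)"
      using gradient_mean_square_le[OF M sy L min] unfolding g_def by (intro mult_left_mono) auto
    \<comment> \<open>The step size gives \<open>h\<^sup>2 = q / (4 * L)\<close>, hence 2 L h^2 =
      q/2.\<close>
    also have "\<dots> = q * ?\<Delta> / 2" using L by (simp add: h2)
    finally show ?thesis .
  qed
  have W_upper: "?W \<le> 2 * A\<^sup>2 * ?V + 8 * m * c\<^sup>2 * ?D"
  proof -
    have "?W \<le> (\<integral>\<omega>. 2 * A\<^sup>2 * (norm (u \<omega>))\<^sup>2 + 2 * a\<^sup>2 * (norm (y \<omega> - xs \<omega>))\<^sup>2 \<partial>M)"
      unfolding mean_square_def
    proof (rule integral_mono)
      fix \<omega>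
      have "(norm (p + z))\<^sup>2 \<le> 2 * (norm p)\<^sup>2 + 2 * (norm z)\<^sup>2" for p z :: 'a
        using zero_le_power2[of "norm (p - z)"]
        by (simp only: power2_norm_eq_inner) (simp add: algebra_simps inner_commute)
      from this[of "A *\<^sub>R u \<omega>" "a *\<^sub>R (y \<omega> - xs \<omega>)"]
      show "(norm (w \<omega>))\<^sup>2 \<le> 2 * A\<^sup>2 * (norm (u \<omega>))\<^sup>2 + 2 * a\<^sup>2 * (norm (y \<omega> - xs \<omega>))\<^sup>2"
        by (simp add: w_def power_mult_distrib)
    qed (use sw su sd in \<open>simp_all add: int\<close>)
    then show ?thesis using su sd by (simp add: int mean_square_def a2)
  qed
  have \<Delta>0: "0 \<le> ?\<Delta>" using min[OF distr_in_P2[OF M sy]] by simp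
  have "q / 4 * (A * ?\<Delta> + ?V / 4 + ?W / 4) \<le> (A\<^sup>2 - 1) / 4 * ?V + q * c * A * P - A\<^sup>2 / 2 * (h\<^sup>2 * ?N)"
    by (rule heavy_ball_decrease_arith[OF q01 c A_c m \<Delta>0 _ _ P_lower N_upper W_upper]) simp_all
  also have "q * c * A * P = h * a * A * P / 2" unfolding ha by simp
  finally have decrease: "q / 4 * (A * ?\<Delta> + ?V / 4 + ?W / 4)
      \<le> (A\<^sup>2 - 1) / 4 * ?V + h * a * A * P / 2 - A\<^sup>2 / 2 * (h\<^sup>2 * ?N)" .
  have "A * (F (distr M borel y) - h * (A * Q + h * A * ?N)) \<le> A * F (distr M borel x)"
    using x_lower A0 by (intro mult_left_mono) auto
  then have "A * (F (distr M borel x) - f) \<ge> A * ?\<Delta> - h * A\<^sup>2 * Q - h\<^sup>2 * A\<^sup>2 * ?N"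
    by (simp add: algebra_simps power2_eq_square)
  \<comment> \<open>In units of h A^2 Q the three parts of \<open>E\<close> contribute -1, 1/2 and
    1/2, so \<open>Q\<close> disappears. In units of h^2 A^2 E|g|^2 they contribute -1, 1/4 and 1/4,
    which leaves -1/2.\<close>
  then have "E x v \<ge> A * ?\<Delta> + A\<^sup>2 * ?V / 4 + ?W / 4 + h * a * A * P / 2 - A\<^sup>2 / 2 * (h\<^sup>2 * ?N)"
    unfolding E_def V_eq W_eq by (simp add: algebra_simps power2_eq_square add_divide_distrib)
  moreover have E_y: "E y u = A * ?\<Delta> + ?V / 4 + ?W / 4" by (simp add: E_def w_def[abs_def])
  moreover have "(A\<^sup>2 - 1) / 4 * ?V = A\<^sup>2 * ?V / 4 - ?V / 4" by (simp add: field_simps)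
  ultimately have "q / 4 * E y u \<le> E x v - E y u"
    using decrease unfolding E_y by linarith
  then show ?thesis by (simp add: distrib_right)
qed

text \<open>The product measure couples the initial law with a minimizer once and for all. The
  iterates remain random vectors on that space, and since the quadratic bounds hold for every
  coupling, none has to be re-optimized along the way.\<close>

proposition heavy_ball_rate:
  assumes m: "m > 0" and L: "L > 0"
    and min: "\<And>\<rho>. \<rho> \<in> P2 \<Longrightarrow> f \<le> F \<rho>" and attained: "f \<in> F ` P2"
    and \<rho>\<^sub>0: "\<rho>\<^sub>0 \<in> P2" and s: "s = m / (16 * L\<^sup>2)"
    and \<beta>: "\<beta> = (1 - sqrt (m * s)) / (1 + sqrt (m * s))"
  shows "\<exists>C\<ge>0. \<forall>k. F (hb_iterate G m s \<beta> \<rho>\<^sub>0 k) - f \<le> C * (1 + m / (16 * L)) powi (- int k)"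
proof -
  obtain \<rho>s where \<rho>s: "\<rho>s \<in> P2" "F \<rho>s = f" using attained by auto
  interpret R: prob_space \<rho>\<^sub>0 by (rule P2_D(1)[OF \<rho>\<^sub>0])
  interpret S: prob_space \<rho>s by (rule P2_D(1)[OF \<rho>s(1)])
  interpret RS: pair_prob_space \<rho>\<^sub>0 \<rho>s ..
  let ?M = "\<rho>\<^sub>0 \<Otimes>\<^sub>M \<rho>s"
  have M: "prob_space ?M" by (rule RS.prob_space_axioms)
  have sets: "sets \<rho>\<^sub>0 = sets borel" "sets \<rho>s = sets borel"
    using P2_D(2) \<rho>\<^sub>0 \<rho>s by auto
  note [measurable_cong] = sets
  have [measurable]: "fst \<in> borel_measurable ?M" "snd \<in> borel_measurable ?M"
    by measurable
  have "distr ?M borel fst = distr ?M \<rho>\<^sub>0 fst" by (intro distr_cong) (simp_all add: sets)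
  then have law_fst: "distr ?M borel fst = \<rho>\<^sub>0" by (simp add: S.distr_pair_fst)
  have "distr ?M borel snd = distr ?M \<rho>s snd" by (intro distr_cong) (simp_all add: sets)
  also have "\<dots> = distr (distr (\<rho>s \<Otimes>\<^sub>M \<rho>\<^sub>0) ?M (\<lambda>(x, y). (y, x))) \<rho>s snd"
    by (simp only: RS.distr_pair_swap[symmetric])
  also have "\<dots> = distr (\<rho>s \<Otimes>\<^sub>M \<rho>\<^sub>0) \<rho>s fst"
    by (subst distr_distr) (auto simp: comp_def case_prod_unfold)
  finally have law: "distr ?M borel fst = \<rho>\<^sub>0" "distr ?M borel snd = \<rho>s"
    using law_fst by (simp_all add: R.distr_pair_fst)
  have sq: "square_integrable ?M fst" "square_integrable ?M snd"
    by (rule square_integrable_of_distr; simp add: law \<rho>\<^sub>0 \<rho>s)+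
  define q where "q = m / (4 * L)"
  define h where "h = q / sqrt m"
  define A where "A = (1 + q) / (1 - q)"
  define a where "a = 2 * sqrt m / (1 - q)"
  have q01: "0 < q" "q < 1"
    using m L modulus_le_lipschitz by (simp_all add: q_def)
  have A0: "0 < A" using q01 by (simp add: A_def)
  \<comment> \<open>The prescribed \<open>s\<close> gives \<open>sqrt s = h\<close> and
    \<open>sqrt (m * s) = q\<close>, whence \<open>\<beta> = 1 / A\<close>: drift and kick are those
    of the Lyapunov step.\<close>
  have sqrt_s: "sqrt s = h"
    using m L by (simp add: s h_def q_def real_sqrt_divide real_sqrt_mult field_simps)
  have "sqrt (m * s) = q" using m by (simp add: real_sqrt_mult sqrt_s h_def)
  then have \<beta>_A: "\<beta> = 1 / A" by (simp add: \<beta> A_def)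
  define E where "E x v = A * (F (distr ?M borel x) - f) + mean_square ?M v / 4
      + mean_square ?M (\<lambda>\<omega>. A *\<^sub>R v \<omega> + a *\<^sub>R (x \<omega> - snd \<omega>)) / 4" for x v :: "'a \<times> 'a \<Rightarrow> 'a"
  define v\<^sub>0 where "v\<^sub>0 \<omega> = - (2 * sqrt s / (1 + sqrt (m * s))) *\<^sub>R G \<rho>\<^sub>0 (fst \<omega>)" for \<omega> :: "'a \<times> 'a"
  have sv\<^sub>0: "square_integrable ?M v\<^sub>0"
    unfolding v\<^sub>0_def using gradient_square_integrable[OF M sq(1)] unfolding law by (rule square_integrable_scaleR)
  have "\<exists>x v. square_integrable ?M x \<and> square_integrable ?M v \<and>
      hb_measure G m s \<beta> \<rho>\<^sub>0 k = distr ?M borel (\<lambda>\<omega>. (x \<omega>, v \<omega>)) \<and> (1 + q / 4) ^ k * E x v \<le> E fst v\<^sub>0" for k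
  proof (induction k)
    case 0
    have "hb_init G m s (distr ?M borel fst) = distr ?M borel (\<lambda>\<omega>. (fst \<omega>, v\<^sub>0 \<omega>))"
      unfolding hb_init_def law(1) v\<^sub>0_def
      using gradient_measurable[OF \<rho>\<^sub>0] by (subst law(1)[symmetric], subst distr_distr) (simp_all add: comp_def)
    then show ?case using sq(1) sv\<^sub>0 by (intro exI[of _ fst] exI[of _ v\<^sub>0]) (simp add: law)
  next
    case (Suc k)
    then obtain x v where IH: "square_integrable ?M x" "square_integrable ?M v"
      "hb_measure G m s \<beta> \<rho>\<^sub>0 k = distr ?M borel (\<lambda>\<omega>. (x \<omega>, v \<omega>))" "(1 + q / 4) ^ k * E x v \<le> E fst v\<^sub>0"
      by blast
    define y where "y = (\<lambda>\<omega>. x \<omega> + h *\<^sub>R v \<omega>)"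
    define u where "u = (\<lambda>\<omega>. (1 / A) *\<^sub>R v \<omega> - h *\<^sub>R G (distr ?M borel y) (y \<omega>))"
    have sy: "square_integrable ?M y" unfolding y_def using IH(1,2) by (intro square_integrable_intros)
    have su: "square_integrable ?M u"
      unfolding u_def using IH(2) gradient_square_integrable[OF M sy] by (intro square_integrable_intros)
    have "hb_measure G m s \<beta> \<rho>\<^sub>0 (Suc k) = distr ?M borel (\<lambda>\<omega>. (y \<omega>, u \<omega>))"
      using hb_step_joint_law[of x ?M v G s \<beta>] IH(1-3) gradient_measurable[OF distr_in_P2[OF M sy]]
      by (simp add: square_integrable_def sqrt_s \<beta>_A y_def u_def)
    moreover have "(1 + q / 4) * E y u \<le> E x v"
      using heavy_ball_lyapunov_step[OF M IH(1,2) sq(2) m L min _ q_def h_def A_def a_def] \<rho>s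
      unfolding E_def y_def u_def law by blast
    then have "(1 + q / 4) ^ k * ((1 + q / 4) * E y u) \<le> (1 + q / 4) ^ k * E x v"
      using q01 by (intro mult_left_mono) auto
    then have "(1 + q / 4) ^ Suc k * E y u \<le> E fst v\<^sub>0" using IH(4) by (simp add: mult_ac)
    ultimately show ?case using sy su by blast
  qed
  note lifted = this
  have E0: "0 \<le> E fst v\<^sub>0"
    using A0 min[OF \<rho>\<^sub>0] by (simp add: E_def law)
  have "F (hb_iterate G m s \<beta> \<rho>\<^sub>0 k) - f \<le> E fst v\<^sub>0 / A * (1 + m / (16 * L)) powi (- int k)" for k
  proof -
    obtain x v where xv: "square_integrable ?M x" "square_integrable ?M v"
      "hb_measure G m s \<beta> \<rho>\<^sub>0 k = distr ?M borel (\<lambda>\<omega>. (x \<omega>, v \<omega>))" "(1 + q / 4) ^ k * E x v \<le> E fst v\<^sub>0"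
      using lifted by blast
    have [measurable]: "x \<in> borel_measurable ?M" "v \<in> borel_measurable ?M"
      using xv by (simp_all add: square_integrable_def)
    have "hb_iterate G m s \<beta> \<rho>\<^sub>0 k = distr ?M borel x"
      unfolding hb_iterate_def xv(3) by (simp add: distr_distr comp_def)
    \<comment> \<open>The two mean squares in \<open>E\<close> are nonnegative and may be
      discarded.\<close>
    then have "A * (F (hb_iterate G m s \<beta> \<rho>\<^sub>0 k) - f) \<le> E x v" by (simp add: E_def)
    also have "\<dots> \<le> E fst v\<^sub>0 / (1 + q / 4) ^ k"
      using xv(4) q01 by (simp add: pos_le_divide_eq mult.commute)
    finally have "F (hb_iterate G m s \<beta> \<rho>\<^sub>0 k) - f \<le> E fst v\<^sub>0 / (1 + q / 4) ^ k / A"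
      using A0 by (subst pos_le_divide_eq) (simp_all add: mult.commute)
    also have "\<dots> = E fst v\<^sub>0 / A * (1 + q / 4) powi (- int k)"
      by (simp add: power_int_minus inverse_eq_divide mult.commute)
    also have "1 + q / 4 = 1 + m / (16 * L)" by (simp add: q_def)
    finally show ?thesis .
  qed
  then show ?thesis using E0 A0 by (intro exI[of _ "E fst v\<^sub>0 / A"]) auto
qed

end

theorem theorem3p1:
  fixes F :: "(real ^ 'd) measure \<Rightarrow> real"
    and gradF :: "(real ^ 'd) measure \<Rightarrow> real ^ 'd \<Rightarrow> real ^ 'd"
    and m L m\<^sub>F s \<beta> :: real
    and \<rho>\<^sub>0 :: "(real ^ 'd) measure"
  assumes "m > 0" and "L > 0"
    and "geodesically_convex m F"
    and "\<And>\<rho>. \<rho> \<in> P2 \<Longrightarrow> wasserstein_differentiable F \<rho>"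
    and "\<And>\<rho>. \<rho> \<in> P2 \<Longrightarrow> is_wasserstein_gradient F \<rho> (gradF \<rho>)"
    and "\<And>\<rho> \<eta> x y. \<rho> \<in> P2 \<Longrightarrow> \<eta> \<in> P2 \<Longrightarrow>
           norm (gradF \<rho> x - gradF \<eta> y) \<le> L / 2 * (norm (x - y) + W2 \<rho> \<eta>)"
    and "m\<^sub>F \<in> F ` P2" and "\<And>\<rho>. \<rho> \<in> P2 \<Longrightarrow> m\<^sub>F \<le> F \<rho>"
    and "\<rho>\<^sub>0 \<in> P2"
    and "s = m / (16 * L\<^sup>2)"
    and "\<beta> = (1 - sqrt (m * s)) / (1 + sqrt (m * s))"
  shows "\<exists>C\<ge>0. \<forall>k. F (hb_iterate gradF m s \<beta> \<rho>\<^sub>0 k) - m\<^sub>F \<le> C * (1 + m / (16 * L)) powi (- int k)"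
proof -
  interpret lipschitz_gradient_functional F gradF m L
    by unfold_locales (use assms(2-6) in \<open>auto simp: is_wasserstein_gradient_def\<close>)
  show ?thesis
    by (rule heavy_ball_rate) fact+
qed

end
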